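(* Let $L$ be an even lattice of signature $(b_+,b_-)$, let $M$ be a primitive non-degenerate sub-lattice of $L$ of signature $(c_+,c_-)$, and let $v\in\operatorname{Gr}(L_{\mathbb{R}})$ be the direct sum $u\oplus u^\perp$ with $u\in\operatorname{Gr}(M_{\mathbb{R}})$ and $u^\perp\in\operatorname{Gr}(M_{\mathbb{R}}^\perp)$. Let $\Gamma$ be a finite index subgroup of $\operatorname{Mp}_2(\mathbb{Z})$, let $\Phi$ be a Jacobi form of weight $(k,l)$ and index $(L,v)$ with respect to $\Gamma$, and decompose $L_{\mathbb{C}}=M_{\mathbb{C}}\oplus M_{\mathbb{C}}^\perp$. Then the map $$\operatorname{Res}^L_M\Phi:\mathcal{H}\times M_{\mathbb{C}}\to\mathbb{C},\qquad\operatorname{Res}^L_M\Phi(\tau,\xi)=\Phi(\tau,\xi+0)\quad\text{with }0\in M_{\mathbb{C}}^\perp,$$ is a Jacobi form of weight $(k,l)$ and index $(M,u)$ with respect to $\Gamma$. Moreover, if $\Phi=\Phi_{L,v}^F$ with $F$ a modular form of weight $\big(k-\frac{b_+}{2},l-\frac{b_-}{2}\big)$ and representation $\rho_L^*$ with respect to $\Gamma$, then $\operatorname{Res}^L_M\Phi=\Phi_{M,u}^{\Theta_{(L,M)}(F;u^\perp)}$.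
   Context: Lattices. An even lattice is a free $\mathbb{Z}$-module $L$ of finite rank with a non-degenerate symmetric bilinear form $(\cdot,\cdot):L\times L\to\mathbb{Z}$ such that $\lambda^2:=(\lambda,\lambda)$ is even for every $\lambda\in L$. Put $L_{\mathbb{R}}=L\otimes\mathbb{R}$, $L_{\mathbb{C}}=L\otimes\mathbb{C}$; the pairing and $\lambda\mapsto\lambda^2$ are extended bilinearly (no complex conjugation). The signature of $L$ is that of $L_{\mathbb{R}}$. The dual lattice is $L^*=\{\lambda\in L_{\mathbb{R}}:(\lambda,L)\subseteq\mathbb{Z}\}\supseteq L$, and $D_L=L^*/L$ is a finite group. $\mathbb{C}[D_L]$ has basis $\{\mathfrak{e}_\gamma\}_{\gamma\in D_L}$. Write $\mathbf{e}(w)=e^{2\pi iw}$ and $\mathcal{H}=\{\tau=x+iy\in\mathbb{C}:y>0\}$. For a real quadratic space $V$ (such as $L_{\mathbb{R}}$), $\operatorname{Gr}(V)$ is the set of orthogonal decompositions $v$: $V=v_+\oplus v_-$ with $v_+$ positive definite and $v_-$ negative definite; $\lambda_{v_\pm}$ is the orthogonal projection of $\lambda$ onto $v_\pm$, extended complex linearly to $\zeta\mapsto\zeta_{v_\pm}$. The Jacobi--Siegel theta function: for $\tau\in\mathcal{H}$, $\zeta\in L_{\mathbb{C}}$, $$\Theta_L(\tau,\zeta;v)=\sum_{\gamma\in D_L}\Big[\sum_{\lambda\in L+\gamma}\mathbf{e}\Big(\tau\tfrac{\lambda_{v_+}^2}{2}+\overline{\tau}\tfrac{\lambda_{v_-}^2}{2}+(\lambda,\zeta)\Big)\Big]\mathfrak{e}_\gamma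 .$$ Metaplectic group. For $A=\begin{pmatrix}a&b\\c&d\end{pmatrix}\in\operatorname{SL}_2(\mathbb{R})$ put $A\tau=\frac{a\tau+b}{c\tau+d}$, $j(A,\tau)=c\tau+d$, $j_A'=c$. $\operatorname{Mp}_2(\mathbb{R})$ is the group of pairs $(A,\phi)$ with $A\in\operatorname{SL}_2(\mathbb{R})$, $\phi:\mathcal{H}\to\mathbb{C}$ holomorphic, $\phi^2(\tau)=j(A,\tau)$, with product $(A,\phi)(B,\psi)=(AB,(\phi\circ B)\psi)$; $\operatorname{Mp}_2(\mathbb{Z})$ is the inverse image of $\operatorname{SL}_2(\mathbb{Z})$. It is generated by $T=\big(\begin{pmatrix}1&1\\0&1\end{pmatrix},1\big)$ and $S=\big(\begin{pmatrix}0&-1\\1&0\end{pmatrix},\sqrt{\tau}\big)$ with $\sqrt\tau\in\mathcal{H}$. The Weil representation $\rho_L$ of $\operatorname{Mp}_2(\mathbb{Z})$ on $\mathbb{C}[D_L]$ is given by $$\rho_L(T)\mathfrak{e}_\gamma=\mathbf{e}(\tfrac{\gamma^2}{2})\mathfrak{e}_\gamma,\qquad \rho_L(S)\mathfrak{e}_\gamma=\frac{\mathbf{e}\big(\frac{b_--b_+}{8}\big)}{\sqrt{|D_L|}}\sum_{\delta\in D_L}\mathbf{e}(-(\gamma,\delta))\mathfrak{e}_\delta .$$ $L(-1)$ is $L$ with the forms negated; $\mathbb{C}[D_{L(-1)}]$ has basis $\{\mathfrak{e}_\gamma^*\}_{\gamma\in D_L}$, regarded as dual to $\{\mathfrak{e}_\gamma\}$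 via the bilinear pairing $\langle\cdot,\cdot\rangle_L:\mathbb{C}[D_L]\times\mathbb{C}[D_{L(-1)}]\to\mathbb{C}$, $\langle\mathfrak{e}_\gamma,\mathfrak{e}_\delta^*\rangle_L=\delta_{\gamma,\delta}$ (extended to further tensor factors in the obvious way). $\rho_L^*=\rho_{L(-1)}$ is the dual representation: $\langle\rho_L(A,\phi)U,\rho_L^*(A,\phi)V\rangle_L=\langle U,V\rangle_L$. Growth. A function $f$ on $\mathcal{H}$ has at most linear exponential growth at the cusps if for every $A\in\operatorname{SL}_2(\mathbb{Z})$ there is a constant $C$ with $f(A\tau)=O(e^{Cy})$ as $y\to\infty$, uniformly for $x$ in bounded sets. Modular forms. For $p,q\in\frac12\mathbb{Z}$, a modular form of weight $(p,q)$ and representation $\rho_L^*$ with respect to $\Gamma$ is a smooth $F:\mathcal{H}\to\mathbb{C}[D_{L(-1)}]$ with $F(A\tau)=\phi(\tau)^{2p}\overline{\phi(\tau)}^{2q}\rho_L^*(A,\phi)F(\tau)$ for all $\tau\in\mathcal{H}$, $(A,\phi)\in\Gamma$, and at most linear exponential growth at the cusps. Jacobi forms. For $k,l\in\frac12\mathbb{Z}$, a Jacobi form of weight $(k,l)$ and index $(L,v)$ with respect to $\Gamma$ is a smooth $\Phi:\mathcal{H}\times L_{\mathbb{C}}\to\mathbb{C}$ such that: (1) for all $\tau,\zeta$ and $\sigma,\nu\in L$, $\Phi(\tau,\zeta+\tau\sigma_{v_+}+\overline\tau\sigma_{v_-}+\nu)=\mathbf{e}\big(-\tau\frac{\sigma_{v_+}^2}{2}-\overline\tau\frac{\sigma_{v_-}^2}{2}-(\sigma,\zeta)\big)\Phi(\tau,\zeta)$;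 (2) for all $\tau,\zeta$ and $(A,\phi)\in\Gamma$, $$\Phi\Big(A\tau,\tfrac{\zeta_{v_+}}{j(A,\tau)}+\tfrac{\zeta_{v_-}}{\overline{j(A,\tau)}}\Big)=\phi(\tau)^{2k}\overline{\phi(\tau)}^{2l}\,\mathbf{e}\Big(\tfrac{j_A'\zeta_{v_+}^2}{2j(A,\tau)}+\tfrac{j_A'\zeta_{v_-}^2}{2\overline{j(A,\tau)}}\Big)\Phi(\tau,\zeta);$$ (3) $\zeta\mapsto\Phi(\tau,\zeta)$ is holomorphic for each $\tau$; (4) the functions $f_\lambda$ ($\lambda\in L^*$) in the Fourier expansion $\Phi(\tau,\zeta)=\sum_{\lambda\in L^*}f_\lambda(\tau)\mathbf{e}\big(\tau\frac{\lambda_{v_+}^2}{2}+\overline\tau\frac{\lambda_{v_-}^2}{2}+(\lambda,\zeta)\big)$ have at most linear exponential growth at the cusps. For $F$ modular of weight $\big(k-\frac{b_+}{2},l-\frac{b_-}{2}\big)$ and representation $\rho_L^*$, $\Phi_{L,v}^F(\tau,\zeta)=\langle\Theta_L(\tau,\zeta;v),F(\tau)\rangle_L$; every Jacobi form of weight $(k,l)$ and index $(L,v)$ is $\Phi_{L,v}^F$ for a unique such $F$. The same notation applies with $(M,u)$ instead of $(L,v)$. Sub-lattices and theta contraction. $M_{\mathbb{R}}^\perp$, $M_{\mathbb{C}}^\perp$ are the orthogonal complements of $M$ in $L_{\mathbb{R}}$, $L_{\mathbb{C}}$. $v=u\oplus u^\perp$ means $v_\pm=u_\pm\oplus u^\perp_\pm$.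 $\pi_M:L^*\to D_M$ is the composition of the surjective projection $L^*\to M^*$ with $M^*\to D_M$; it, the class $\lambda+L$, and the projections of $\lambda$ to $M_{\mathbb{R}}^\perp$ and $u^\perp_\pm$ are well defined for $\lambda\in L^*/M$. Put $$\Theta_{L,M}(\tau;u^\perp)=\sum_{\delta\in D_M}\ \sum_{\lambda\in L^*/M,\ \pi_M(\lambda)=\delta}\mathbf{e}\Big(\tau\tfrac{\lambda_{u^\perp_+}^2}{2}+\overline\tau\tfrac{\lambda_{u^\perp_-}^2}{2}\Big)\mathfrak{e}_{\lambda+L}\otimes\mathfrak{e}_\delta^*\in\mathbb{C}[D_L]\otimes\mathbb{C}[D_{M(-1)}].$$ The theta contraction of $F$ is $\Theta_{(L,M)}(F;u^\perp):\mathcal{H}\to\mathbb{C}[D_{M(-1)}]$, $\tau\mapsto\langle\Theta_{L,M}(\tau;u^\perp),F(\tau)\rangle_L$; it is a modular form of representation $\rho_M^*$ and weight obtained from that of $F$ by adding $\big(\frac{b_+-c_+}{2},\frac{b_--c_-}{2}\big)$. *)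

theory Defs
  imports "HOL-Analysis.Analysis" "HOL-Algebra.Coset" "HOL-Algebra.Bij"
begin

section \<open>Even lattices\<close>

text \<open>
  A lattice is the \<open>\<int>\<close>-span \<open>L\<close> of a finite linearly independent subset of some \<open>\<real>\<^sup>n\<close>, not
  necessarily of full rank, so that \<open>span L\<close> is a model of \<open>L \<otimes> \<real>\<close> both for a lattice and for its
  sub-lattices.  The form is a bilinear form \<open>B\<close> on all of \<open>\<real>\<^sup>n\<close>, of which only the values on
  \<open>span L\<close> matter.
\<close>

definition int_span :: "(real ^ 'n) set \<Rightarrow> (real ^ 'n) set" where
  "int_span b = {\<Sum>x\<in>b. of_int (c x) *\<^sub>R x | c :: real ^ 'n \<Rightarrow> int. True}"

definition even_lattice :: "(real ^ 'n \<Rightarrow> real ^ 'n \<Rightarrow> real) \<Rightarrow> (real ^ 'n) set \<Rightarrow> bool" where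
  "even_lattice B L \<longleftrightarrow>
     bilinear B \<and> (\<forall>x y. B x y = B y x) \<and>
     (\<exists>b. finite b \<and> independent b \<and> L = int_span b) \<and>
     (\<forall>x\<in>L. \<forall>y\<in>L. B x y \<in> \<int>) \<and>
     (\<forall>x\<in>L. \<exists>m::int. B x x = 2 * of_int m) \<and>
     (\<forall>x\<in>L. (\<forall>y\<in>L. B x y = 0) \<longrightarrow> x = 0)"

definition primitive_nondeg_sublattice ::
  "(real ^ 'n \<Rightarrow> real ^ 'n \<Rightarrow> real) \<Rightarrow> (real ^ 'n) set \<Rightarrow> (real ^ 'n) set \<Rightarrow> bool" where
  "primitive_nondeg_sublattice B M L \<longleftrightarrow>
     M \<subseteq> L \<and> even_lattice B M \<and>
     (\<forall>x\<in>L. \<forall>m::int. m \<noteq> 0 \<and> of_int m *\<^sub>R x \<in> M \<longrightarrow> x \<in> M)"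

definition neg_form :: "(real ^ 'n \<Rightarrow> real ^ 'n \<Rightarrow> real) \<Rightarrow> real ^ 'n \<Rightarrow> real ^ 'n \<Rightarrow> real" where
  "neg_form B = (\<lambda>x y. - B x y)"

definition pos_def_on :: "(real ^ 'n \<Rightarrow> real ^ 'n \<Rightarrow> real) \<Rightarrow> (real ^ 'n) set \<Rightarrow> bool" where
  "pos_def_on B U \<longleftrightarrow> (\<forall>x\<in>U. x \<noteq> 0 \<longrightarrow> B x x > 0)"

definition neg_def_on :: "(real ^ 'n \<Rightarrow> real ^ 'n \<Rightarrow> real) \<Rightarrow> (real ^ 'n) set \<Rightarrow> bool" where
  "neg_def_on B U \<longleftrightarrow> (\<forall>x\<in>U. x \<noteq> 0 \<longrightarrow> B x x < 0)"

definition signature ::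
  "(real ^ 'n \<Rightarrow> real ^ 'n \<Rightarrow> real) \<Rightarrow> (real ^ 'n) set \<Rightarrow> nat \<times> nat" where
  "signature B L =
     (Max {dim U | U. subspace U \<and> U \<subseteq> span L \<and> pos_def_on B U},
      Max {dim U | U. subspace U \<and> U \<subseteq> span L \<and> neg_def_on B U})"

definition dual_lattice ::
  "(real ^ 'n \<Rightarrow> real ^ 'n \<Rightarrow> real) \<Rightarrow> (real ^ 'n) set \<Rightarrow> (real ^ 'n) set" where
  "dual_lattice B L = {x \<in> span L. \<forall>y\<in>L. B x y \<in> \<int>}"

definition coset :: "(real ^ 'n) set \<Rightarrow> real ^ 'n \<Rightarrow> (real ^ 'n) set" where
  "coset L x = (+) x ` L"

definition disc_group ::
  "(real ^ 'n \<Rightarrow> real ^ 'n \<Rightarrow> real) \<Rightarrow> (real ^ 'n) set \<Rightarrow> (real ^ 'n) set set" where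
  "disc_group B L = coset L ` dual_lattice B L"

text \<open>A representative of a coset; used only where the result does not depend on the choice.\<close>

definition repr :: "(real ^ 'n) set \<Rightarrow> real ^ 'n" where
  "repr \<gamma> = (SOME x. x \<in> \<gamma>)"

definition orth_compl ::
  "(real ^ 'n \<Rightarrow> real ^ 'n \<Rightarrow> real) \<Rightarrow> (real ^ 'n) set \<Rightarrow> (real ^ 'n) set \<Rightarrow> (real ^ 'n) set" where
  "orth_compl B L M = {x \<in> span L. \<forall>y\<in>span M. B x y = 0}"

text \<open>The elements \<open>v\<close> of the Grassmannian are pairs \<open>(v\<^sub>+, v\<^sub>-)\<close>.\<close>

definition Gr :: "(real ^ 'n \<Rightarrow> real ^ 'n \<Rightarrow> real) \<Rightarrow> (real ^ 'n) set
    \<Rightarrow> ((real ^ 'n) set \<times> (real ^ 'n) set) set" where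
  "Gr B V = {(vp, vm). subspace vp \<and> subspace vm \<and> pos_def_on B vp \<and> neg_def_on B vm \<and>
     (\<forall>x\<in>vp. \<forall>y\<in>vm. B x y = 0) \<and> V = {x + y | x y. x \<in> vp \<and> y \<in> vm}}"

definition Gr_sum :: "(real ^ 'n) set \<times> (real ^ 'n) set \<Rightarrow> (real ^ 'n) set \<times> (real ^ 'n) set
    \<Rightarrow> (real ^ 'n) set \<times> (real ^ 'n) set" where
  "Gr_sum u w = ({x + y | x y. x \<in> fst u \<and> y \<in> fst w}, {x + y | x y. x \<in> snd u \<and> y \<in> snd w})"

text \<open>The \<open>B\<close>-orthogonal projection onto \<open>U\<close>, for \<open>B\<close> non-degenerate on \<open>U\<close>.\<close>

definition oproj ::
  "(real ^ 'n \<Rightarrow> real ^ 'n \<Rightarrow> real) \<Rightarrow> (real ^ 'n) set \<Rightarrow> real ^ 'n \<Rightarrow> real ^ 'n" where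
  "oproj B U x = (THE y. y \<in> U \<and> (\<forall>z\<in>U. B (x - y) z = 0))"

section \<open>Complexification\<close>

definition cvec :: "real ^ 'n \<Rightarrow> complex ^ 'n" where
  "cvec x = (\<chi> i. of_real (x $ i))"

definition vRe :: "complex ^ 'n \<Rightarrow> real ^ 'n" where
  "vRe \<zeta> = (\<chi> i. Re (\<zeta> $ i))"

definition vIm :: "complex ^ 'n \<Rightarrow> real ^ 'n" where
  "vIm \<zeta> = (\<chi> i. Im (\<zeta> $ i))"

definition complexify :: "(real ^ 'n) set \<Rightarrow> (complex ^ 'n) set" where
  "complexify V = {\<zeta>. vRe \<zeta> \<in> V \<and> vIm \<zeta> \<in> V}"

text \<open>Complex bilinear (not sesquilinear) extension.\<close>

definition cform ::
  "(real ^ 'n \<Rightarrow> real ^ 'n \<Rightarrow> real) \<Rightarrow> complex ^ 'n \<Rightarrow> complex ^ 'n \<Rightarrow> complex" where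
  "cform B \<zeta> \<xi> = Complex (B (vRe \<zeta>) (vRe \<xi>) - B (vIm \<zeta>) (vIm \<xi>))
                         (B (vRe \<zeta>) (vIm \<xi>) + B (vIm \<zeta>) (vRe \<xi>))"

definition coproj ::
  "(real ^ 'n \<Rightarrow> real ^ 'n \<Rightarrow> real) \<Rightarrow> (real ^ 'n) set \<Rightarrow> complex ^ 'n \<Rightarrow> complex ^ 'n" where
  "coproj B U \<zeta> = cvec (oproj B U (vRe \<zeta>)) + \<i> *s cvec (oproj B U (vIm \<zeta>))"

section \<open>Smooth and holomorphic functions\<close>

text \<open>
  Both notions are meant for sets that are open in a linear subspace of the ambient space, namely
  in the linear span of the set; only derivatives along the span are determined by the function.
\<close>

primrec Ck_on ::
  "nat \<Rightarrow> ('a::real_normed_vector \<Rightarrow> 'b::real_normed_vector) \<Rightarrow> 'a set \<Rightarrow> bool" where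
  "Ck_on 0 f S \<longleftrightarrow> continuous_on S f"
| "Ck_on (Suc m) f S \<longleftrightarrow> (\<exists>f'. (\<forall>x\<in>S. (f has_derivative f' x) (at x within S)) \<and>
     (\<forall>h\<in>span S. Ck_on m (\<lambda>x. f' x h) S))"

definition smooth_on ::
  "'a set \<Rightarrow> ('a::real_normed_vector \<Rightarrow> 'b::real_normed_vector) \<Rightarrow> bool" where
  "smooth_on S f \<longleftrightarrow> (\<forall>m. Ck_on m f S)"

definition holomorphic_vec_on :: "(complex ^ 'n \<Rightarrow> complex) \<Rightarrow> (complex ^ 'n) set \<Rightarrow> bool" where
  "holomorphic_vec_on f S \<longleftrightarrow> (\<forall>\<zeta>\<in>S. \<exists>f'. (f has_derivative f') (at \<zeta> within S) \<and>
     (\<forall>c. \<forall>h\<in>span S. f' (c *s h) = c * f' h))"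

section \<open>The metaplectic group\<close>

definition uhp :: "complex set" where
  "uhp = {\<tau>. Im \<tau> > 0}"

definition e2pi :: "complex \<Rightarrow> complex" where
  "e2pi w = exp (2 * of_real pi * \<i> * w)"

definition mob :: "real ^ 2 ^ 2 \<Rightarrow> complex \<Rightarrow> complex" where
  "mob A = moebius (of_real (A $ 1 $ 1)) (of_real (A $ 1 $ 2))
                   (of_real (A $ 2 $ 1)) (of_real (A $ 2 $ 2))"

definition autj :: "real ^ 2 ^ 2 \<Rightarrow> complex \<Rightarrow> complex" where
  "autj A \<tau> = of_real (A $ 2 $ 1) * \<tau> + of_real (A $ 2 $ 2)"

definition autj' :: "real ^ 2 ^ 2 \<Rightarrow> complex" where
  "autj' A = of_real (A $ 2 $ 1)"

definition SL2Z :: "(real ^ 2 ^ 2) set" where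
  "SL2Z = {A. det A = 1 \<and> (\<forall>i j. A $ i $ j \<in> \<int>)}"

type_synonym mp = "(real ^ 2 ^ 2) \<times> (complex \<Rightarrow> complex)"

text \<open>Functions on the upper half plane are represented by their extensional extensions.\<close>

definition Mp2R :: "mp monoid" where
  "Mp2R = \<lparr>carrier = {(A, \<phi>). det A = 1 \<and> \<phi> \<in> extensional uhp \<and> \<phi> holomorphic_on uhp \<and>
                        (\<forall>\<tau>\<in>uhp. (\<phi> \<tau>)\<^sup>2 = autj A \<tau>)},
           mult = (\<lambda>(A, \<phi>) (B, \<psi>). (A ** B, \<lambda>\<tau>\<in>uhp. \<phi> (mob B \<tau>) * \<psi> \<tau>)),
           one = (mat 1, \<lambda>\<tau>\<in>uhp. 1)\<rparr>"

definition Mp2Z :: "mp monoid" where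
  "Mp2Z = Mp2R\<lparr>carrier := {g \<in> carrier Mp2R. fst g \<in> SL2Z}\<rparr>"

definition mpT :: mp where
  "mpT = (vector [vector [1, 1], vector [0, 1]], \<lambda>\<tau>\<in>uhp. 1)"

definition mpS :: mp where
  "mpS = (vector [vector [0, -1], vector [1, 0]], \<lambda>\<tau>\<in>uhp. csqrt \<tau>)"

definition finite_index_subgroup :: "mp set \<Rightarrow> bool" where
  "finite_index_subgroup \<Gamma> \<longleftrightarrow> subgroup \<Gamma> Mp2Z \<and> finite (rcosets\<^bsub>Mp2Z\<^esub> \<Gamma>)"

section \<open>The Weil representation\<close>

text \<open>
  The space \<open>\<complex>[D]\<close> consists of the functions on \<open>D\<close>, extended by zero; \<open>basis_vec \<gamma>\<close> is the
  basis vector of \<open>\<gamma>\<close>.  A lattice and its negative have the same dual lattice and the same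
  cosets, so the same space serves for both, and \<open>pairing\<close> makes the two bases dual.
\<close>

definition fun_space :: "'d set \<Rightarrow> ('d \<Rightarrow> complex) set" where
  "fun_space D = {U. \<forall>\<gamma>. \<gamma> \<notin> D \<longrightarrow> U \<gamma> = 0}"

definition basis_vec :: "'d \<Rightarrow> 'd \<Rightarrow> complex" where
  "basis_vec \<gamma> = (\<lambda>\<delta>. if \<delta> = \<gamma> then 1 else 0)"

definition pairing :: "'d set \<Rightarrow> ('d \<Rightarrow> complex) \<Rightarrow> ('d \<Rightarrow> complex) \<Rightarrow> complex" where
  "pairing D U V = (\<Sum>\<gamma>\<in>D. U \<gamma> * V \<gamma>)"

definition linear_fun_space :: "'d set \<Rightarrow> (('d \<Rightarrow> complex) \<Rightarrow> ('d \<Rightarrow> complex)) \<Rightarrow> bool" where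
  "linear_fun_space D R \<longleftrightarrow> (\<forall>U\<in>fun_space D. \<forall>V\<in>fun_space D. \<forall>a b.
     R (\<lambda>\<gamma>. a * U \<gamma> + b * V \<gamma>) = (\<lambda>\<gamma>. a * R U \<gamma> + b * R V \<gamma>))"

text \<open>
  The representation is determined by its values on \<open>mpT\<close> and \<open>mpS\<close>, which generate
  \<open>Mp2Z\<close>.
\<close>

definition weil_rep :: "(real ^ 'n \<Rightarrow> real ^ 'n \<Rightarrow> real) \<Rightarrow> (real ^ 'n) set
    \<Rightarrow> mp \<Rightarrow> ((real ^ 'n) set \<Rightarrow> complex) \<Rightarrow> ((real ^ 'n) set \<Rightarrow> complex)" where
  "weil_rep B L = (let D = disc_group B L; (bp, bm) = signature B L in
     THE \<rho>. \<rho> \<in> hom Mp2Z (BijGroup (fun_space D)) \<and> \<rho> \<in> extensional (carrier Mp2Z) \<and>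
       (\<forall>g\<in>carrier Mp2Z. linear_fun_space D (\<rho> g)) \<and>
       (\<forall>\<gamma>\<in>D. \<rho> mpT (basis_vec \<gamma>) =
          (\<lambda>\<delta>. e2pi (of_real (B (repr \<gamma>) (repr \<gamma>) / 2)) * basis_vec \<gamma> \<delta>)) \<and>
       (\<forall>\<gamma>\<in>D. \<rho> mpS (basis_vec \<gamma>) =
          (\<lambda>\<delta>. e2pi ((of_nat bm - of_nat bp) / 8) / of_real (sqrt (real (card D))) *
                (\<Sum>\<epsilon>\<in>D. e2pi (- of_real (B (repr \<gamma>) (repr \<epsilon>))) * basis_vec \<epsilon> \<delta>))))"

definition weil_rep_dual :: "(real ^ 'n \<Rightarrow> real ^ 'n \<Rightarrow> real) \<Rightarrow> (real ^ 'n) set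
    \<Rightarrow> mp \<Rightarrow> ((real ^ 'n) set \<Rightarrow> complex) \<Rightarrow> ((real ^ 'n) set \<Rightarrow> complex)" where
  "weil_rep_dual B L = weil_rep (neg_form B) L"

section \<open>Modular forms and Jacobi forms\<close>

definition lin_exp_growth :: "(complex \<Rightarrow> complex) \<Rightarrow> bool" where
  "lin_exp_growth f \<longleftrightarrow> (\<forall>A\<in>SL2Z. \<exists>C::real. \<forall>X::real set. bounded X \<longrightarrow>
     (\<exists>K Y. \<forall>x\<in>X. \<forall>y>0. y \<ge> Y \<longrightarrow> norm (f (mob A (Complex x y))) \<le> K * exp (C * y)))"

text \<open>
  Weights are half-integral, so the exponents \<open>2p\<close> and \<open>2q\<close> of \<open>\<phi>\<close> and its conjugate are
  integers.
\<close>

definition modular_form :: "real \<Rightarrow> real \<Rightarrow> (real ^ 'n \<Rightarrow> real ^ 'n \<Rightarrow> real) \<Rightarrow> (real ^ 'n) set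
    \<Rightarrow> mp set \<Rightarrow> (complex \<Rightarrow> (real ^ 'n) set \<Rightarrow> complex) \<Rightarrow> bool" where
  "modular_form p q B L \<Gamma> F \<longleftrightarrow>
     2 * p \<in> \<int> \<and> 2 * q \<in> \<int> \<and>
     (\<forall>\<tau>\<in>uhp. F \<tau> \<in> fun_space (disc_group B L)) \<and>
     (\<forall>\<gamma>\<in>disc_group B L. smooth_on uhp (\<lambda>\<tau>. F \<tau> \<gamma>)) \<and>
     (\<forall>\<tau>\<in>uhp. \<forall>(A, \<phi>)\<in>\<Gamma>. F (mob A \<tau>) =
        (\<lambda>\<gamma>. \<phi> \<tau> powi \<lfloor>2 * p\<rfloor> * cnj (\<phi> \<tau>) powi \<lfloor>2 * q\<rfloor> * weil_rep_dual B L (A, \<phi>) (F \<tau>) \<gamma>)) \<and>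
     (\<forall>\<gamma>\<in>disc_group B L. lin_exp_growth (\<lambda>\<tau>. F \<tau> \<gamma>))"

text \<open>The exponential \<open>\<^bold>e(\<tau> \<lambda>\<^sub>+\<^sup>2 / 2 + cnj \<tau> \<lambda>\<^sub>-\<^sup>2 / 2)\<close>, with respect to \<open>v = (v\<^sub>+, v\<^sub>-)\<close>.\<close>

definition gauss_exp :: "(real ^ 'n \<Rightarrow> real ^ 'n \<Rightarrow> real) \<Rightarrow> (real ^ 'n) set \<times> (real ^ 'n) set
    \<Rightarrow> complex \<Rightarrow> real ^ 'n \<Rightarrow> complex" where
  "gauss_exp B v \<tau> x =
     e2pi (\<tau> * of_real (B (oproj B (fst v) x) (oproj B (fst v) x)) / 2 +
           cnj \<tau> * of_real (B (oproj B (snd v) x) (oproj B (snd v) x)) / 2)"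

definition jacobi_form :: "real \<Rightarrow> real \<Rightarrow> (real ^ 'n \<Rightarrow> real ^ 'n \<Rightarrow> real) \<Rightarrow> (real ^ 'n) set
    \<Rightarrow> (real ^ 'n) set \<times> (real ^ 'n) set \<Rightarrow> mp set \<Rightarrow> (complex \<times> (complex ^ 'n) \<Rightarrow> complex) \<Rightarrow> bool" where
  "jacobi_form k l B L v \<Gamma> \<Phi> \<longleftrightarrow>
     2 * k \<in> \<int> \<and> 2 * l \<in> \<int> \<and>
     smooth_on (uhp \<times> complexify (span L)) \<Phi> \<and>
     (\<forall>\<tau>\<in>uhp. \<forall>\<zeta>\<in>complexify (span L). \<forall>\<sigma>\<in>L. \<forall>\<nu>\<in>L.
        \<Phi> (\<tau>, \<zeta> + \<tau> *s cvec (oproj B (fst v) \<sigma>) + cnj \<tau> *s cvec (oproj B (snd v) \<sigma>) + cvec \<nu>) =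
        e2pi (- \<tau> * of_real (B (oproj B (fst v) \<sigma>) (oproj B (fst v) \<sigma>)) / 2
              - cnj \<tau> * of_real (B (oproj B (snd v) \<sigma>) (oproj B (snd v) \<sigma>)) / 2
              - cform B (cvec \<sigma>) \<zeta>) * \<Phi> (\<tau>, \<zeta>)) \<and>
     (\<forall>\<tau>\<in>uhp. \<forall>\<zeta>\<in>complexify (span L). \<forall>(A, \<phi>)\<in>\<Gamma>.
        \<Phi> (mob A \<tau>, inverse (autj A \<tau>) *s coproj B (fst v) \<zeta>
                     + inverse (cnj (autj A \<tau>)) *s coproj B (snd v) \<zeta>) =
        \<phi> \<tau> powi \<lfloor>2 * k\<rfloor> * cnj (\<phi> \<tau>) powi \<lfloor>2 * l\<rfloor> *
        e2pi (autj' A * cform B (coproj B (fst v) \<zeta>) (coproj B (fst v) \<zeta>) / (2 * autj A \<tau>)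
              + autj' A * cform B (coproj B (snd v) \<zeta>) (coproj B (snd v) \<zeta>) / (2 * cnj (autj A \<tau>))) *
        \<Phi> (\<tau>, \<zeta>)) \<and>
     (\<forall>\<tau>\<in>uhp. holomorphic_vec_on (\<lambda>\<zeta>. \<Phi> (\<tau>, \<zeta>)) (complexify (span L))) \<and>
     (\<exists>f. (\<forall>\<tau>\<in>uhp. \<forall>\<zeta>\<in>complexify (span L).
             ((\<lambda>x. f x \<tau> * (gauss_exp B v \<tau> x * e2pi (cform B (cvec x) \<zeta>))) has_sum \<Phi> (\<tau>, \<zeta>))
               (dual_lattice B L)) \<and>
          (\<forall>x\<in>dual_lattice B L. lin_exp_growth (f x)))"

section \<open>Theta functions\<close>

text \<open>An element \<open>\<gamma>\<close> of the discriminant group is itself the set \<open>L + \<gamma>\<close> of lattice translates.\<close>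

definition siegel_theta :: "(real ^ 'n \<Rightarrow> real ^ 'n \<Rightarrow> real) \<Rightarrow> (real ^ 'n) set
    \<Rightarrow> (real ^ 'n) set \<times> (real ^ 'n) set \<Rightarrow> complex \<Rightarrow> complex ^ 'n \<Rightarrow> (real ^ 'n) set \<Rightarrow> complex" where
  "siegel_theta B L v \<tau> \<zeta> = (\<lambda>\<gamma>. if \<gamma> \<in> disc_group B L
     then \<Sum>\<^sub>\<infinity>x\<in>\<gamma>. gauss_exp B v \<tau> x * e2pi (cform B (cvec x) \<zeta>) else 0)"

definition Phi_of :: "(real ^ 'n \<Rightarrow> real ^ 'n \<Rightarrow> real) \<Rightarrow> (real ^ 'n) set
    \<Rightarrow> (real ^ 'n) set \<times> (real ^ 'n) set \<Rightarrow> (complex \<Rightarrow> (real ^ 'n) set \<Rightarrow> complex)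
    \<Rightarrow> complex \<times> (complex ^ 'n) \<Rightarrow> complex" where
  "Phi_of B L v F = (\<lambda>(\<tau>, \<zeta>). pairing (disc_group B L) (siegel_theta B L v \<tau> \<zeta>) (F \<tau>))"

definition disc_proj ::
  "(real ^ 'n \<Rightarrow> real ^ 'n \<Rightarrow> real) \<Rightarrow> (real ^ 'n) set \<Rightarrow> real ^ 'n \<Rightarrow> (real ^ 'n) set" where
  "disc_proj B M x = coset M (oproj B (span M) x)"

text \<open>
  Elements of the tensor product are given by their coefficients at
  \<open>basis_vec \<gamma> \<otimes> basis_vec \<delta>\<close>.  The summation variable \<open>\<kappa>\<close> runs over the elements of \<open>L\<^sup>*/M\<close>,
  i.e. over cosets of \<open>M\<close>.
\<close>

definition theta_LM :: "(real ^ 'n \<Rightarrow> real ^ 'n \<Rightarrow> real) \<Rightarrow> (real ^ 'n) set \<Rightarrow> (real ^ 'n) set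
    \<Rightarrow> (real ^ 'n) set \<times> (real ^ 'n) set \<Rightarrow> complex
    \<Rightarrow> (real ^ 'n) set \<Rightarrow> (real ^ 'n) set \<Rightarrow> complex" where
  "theta_LM B L M w \<tau> = (\<lambda>\<gamma> \<delta>. if \<gamma> \<in> disc_group B L \<and> \<delta> \<in> disc_group B M
     then \<Sum>\<^sub>\<infinity>\<kappa> \<in> {\<kappa> \<in> coset M ` dual_lattice B L.
                  disc_proj B M (repr \<kappa>) = \<delta> \<and> coset L (repr \<kappa>) = \<gamma>}. gauss_exp B w \<tau> (repr \<kappa>)
     else 0)"

definition theta_contraction :: "(real ^ 'n \<Rightarrow> real ^ 'n \<Rightarrow> real) \<Rightarrow> (real ^ 'n) set \<Rightarrow> (real ^ 'n) set
    \<Rightarrow> (real ^ 'n) set \<times> (real ^ 'n) set \<Rightarrow> (complex \<Rightarrow> (real ^ 'n) set \<Rightarrow> complex)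
    \<Rightarrow> complex \<Rightarrow> (real ^ 'n) set \<Rightarrow> complex" where
  "theta_contraction B L M w F =
     (\<lambda>\<tau> \<delta>. pairing (disc_group B L) (\<lambda>\<gamma>. theta_LM B L M w \<tau> \<gamma> \<delta>) (F \<tau>))"

text \<open>
  The decomposition of \<open>L\<^sub>\<complex>\<close> as the sum of \<open>M\<^sub>\<complex>\<close> and its complement is internal to \<open>\<complex>\<^sup>n\<close>.
\<close>

definition Res_LM :: "(real ^ 'n) set \<Rightarrow> (complex \<times> (complex ^ 'n) \<Rightarrow> complex)
    \<Rightarrow> complex \<times> (complex ^ 'n) \<Rightarrow> complex" where
  "Res_LM M \<Phi> = (\<lambda>(\<tau>, \<xi>) \<in> uhp \<times> complexify (span M). \<Phi> (\<tau>, \<xi> + 0))"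

end

theory Submission
  imports Defs
begin

text \<open>
  For \<open>\<xi>\<close> in \<open>M\<^sub>\<complex>\<close> the pairing of \<open>\<lambda>\<close> with \<open>\<xi>\<close> depends only on the projection \<open>\<lambda>\<^sub>M\<close>, and the Gaussian
  of \<open>v\<close> at \<open>\<lambda>\<close> is that of \<open>u\<close> at \<open>\<lambda>\<^sub>M\<close> times that of \<open>u\<^sup>\<bottom>\<close> at \<open>\<lambda>\<close>.  Grouping the Fourier series of
  \<open>\<Phi>\<close> by \<open>\<lambda>\<^sub>M\<close> hence gives the series of the restriction, with coefficients
  \<open>g\<^sub>\<mu> = \<Sum> f\<^sub>\<lambda> \<^bold>e(\<tau> \<lambda>\<^sub>+\<^sup>2 / 2 + cnj \<tau> \<lambda>\<^sub>-\<^sup>2 / 2)\<close>, where \<open>\<lambda>\<close> runs over the elements of \<open>L\<^sup>*\<close> above \<open>\<mu>\<close> and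
  is projected to \<open>u\<^sup>\<bottom>\<close>.  The growth of \<open>g\<^sub>\<mu>\<close> at the cusps is elementary: by the
  quasi-periodicity of \<open>\<Phi>\<close> and the uniqueness of Fourier coefficients \<open>f\<^sub>\<lambda>\<close> depends only on \<open>\<lambda> + L\<close>, so
  the bounds on the \<open>f\<^sub>\<lambda>\<close> are uniform, and a definite Gaussian sum over a lattice at height \<open>y\<close> is at
  most a power of \<open>1 + 1/y\<close> times \<open>exp (C y)\<close>.
\<close>

section \<open>Restriction of smooth and holomorphic functions\<close>

text \<open>The derivative chosen within \<open>S\<close> is also one within \<open>T\<close>, and
  directions in \<open>span T\<close> lie in \<open>span S\<close>. The induction keeps
  \<open>f\<close> and \<open>g\<close> arbitrary because its hypothesis is applied to the
  directional derivatives \<open>\<lambda>x. f' x h\<close>.\<close>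

lemma Ck_on_subset_cong:
  assumes "Ck_on m f S" "T \<subseteq> S" "\<And>x. x \<in> T \<Longrightarrow> f x = g x"
  shows "Ck_on m g T"
  using assms
proof (induction m arbitrary: f g)
  case 0
  then show ?case
    by (metis Ck_on.simps(1) continuous_on_cong continuous_on_subset)
next
  case (Suc m)
  from Suc.prems(1) obtain f' where f': "\<forall>x\<in>S. (f has_derivative f' x) (at x within S)"
    "\<forall>h\<in>span S. Ck_on m (\<lambda>x. f' x h) S"
    unfolding Ck_on.simps by blast
  have "(g has_derivative f' x) (at x within T)" if x: "x \<in> T" for x
  proof -
    have "(f has_derivative f' x) (at x within S)"
      using f'(1) x Suc.prems(2) by blast
    from has_derivative_subset[OF this Suc.prems(2)] show ?thesis
      by (rule has_derivative_transform[OF x, rotated]) (simp add: Suc.prems(3))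
  qed
  moreover have "Ck_on m (\<lambda>x. f' x h) T" if "h \<in> span T" for h
  proof -
    have "Ck_on m (\<lambda>x. f' x h) S"
      using f'(2) span_mono[OF Suc.prems(2)] that by blast
    then show ?thesis
      by (rule Suc.IH[OF _ Suc.prems(2)]) simp
  qed
  ultimately show ?case unfolding Ck_on.simps by blast
qed

lemma smooth_on_subset_cong:
  "smooth_on S f \<Longrightarrow> T \<subseteq> S \<Longrightarrow> (\<And>x. x \<in> T \<Longrightarrow> f x = g x) \<Longrightarrow> smooth_on T g"
  unfolding smooth_on_def by (intro allI, rule Ck_on_subset_cong[of _ f S]) auto

lemma holomorphic_vec_on_subset_cong:
  assumes "holomorphic_vec_on f S" "T \<subseteq> S" "\<And>x. x \<in> T \<Longrightarrow> f x = g x"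
  shows "holomorphic_vec_on g T"
  unfolding holomorphic_vec_on_def
proof
  fix x assume x: "x \<in> T"
  then obtain f' where f': "(f has_derivative f') (at x within S)"
    "\<forall>c. \<forall>h\<in>span S. f' (c *s h) = c * f' h"
    using assms unfolding holomorphic_vec_on_def by blast
  have "(g has_derivative f') (at x within T)"
    using has_derivative_subset[OF f'(1) assms(2)]
    by (rule has_derivative_transform[OF x, rotated]) (simp add: assms(3))
  then show "\<exists>f'. (g has_derivative f') (at x within T) \<and>
      (\<forall>c. \<forall>h\<in>span T. f' (c *s h) = c * f' h)"
    using f'(2) span_mono[OF assms(2)] by blast
qed

section \<open>Gaussian sums over lattices\<close>

text \<open>The map sending \<open>x\<close> to \<open>(p x, x)\<close> turns the series into one
  over a disjoint union of fibers, which may be summed fiber by fiber because summability passes to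
  subsets.\<close>

lemma has_sum_fibers:
  fixes h :: "'a \<Rightarrow> complex"
  assumes "(h has_sum s) A" "\<And>x. x \<in> A \<Longrightarrow> p x \<in> C"
  shows "((\<lambda>y. \<Sum>\<^sub>\<infinity>x\<in>{x\<in>A. p x = y}. h x) has_sum s) C"
proof (rule has_sum_SigmaD[where B = "\<lambda>y. {x\<in>A. p x = y}" and f = "\<lambda>(y, x). h x"])
  have "bij_betw (\<lambda>x. (p x, x)) A (Sigma C (\<lambda>y. {x\<in>A. p x = y}))"
    by (rule bij_betwI[where g = snd]) (use assms(2) in auto)
  from has_sum_reindex_bij_betw[OF this, of "\<lambda>(y, x). h x"]
  show "((\<lambda>(y, x). h x) has_sum s) (Sigma C (\<lambda>y. {x\<in>A. p x = y}))"
    using assms(1) by simp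
next
  fix y assume "y \<in> C"
  have "h summable_on {x\<in>A. p x = y}"
    using has_sum_imp_summable[OF assms(1)] by (rule summable_on_subset) auto
  then show "((\<lambda>x. case (y, x) of (y, x) \<Rightarrow> h x) has_sum (\<Sum>\<^sub>\<infinity>x\<in>{x\<in>A. p x = y}. h x))
      {x\<in>A. p x = y}"
    by simp
qed

text \<open>For positive \<open>n\<close> the square is at least \<open>n\<close>, so each half is
  dominated by the geometric series with ratio \<open>exp (- t)\<close>; its value is at most 1/t
  because 1 + t \<le> exp t. The bound does not depend on the finite set \<open>J\<close>.\<close>

lemma sum_exp_neg_square_le:
  fixes t :: real
  assumes "t > 0" "finite J"
  shows "(\<Sum>n\<in>J. exp (- t * (of_int n)\<^sup>2)) \<le> 1 + 2 / t"
proof -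
  define q where "q = exp (- t)"
  have q: "0 < q" "q < 1" using assms by (auto simp: q_def)
  have qe: "q / (1 - q) \<le> 1 / t"
  proof -
    have "1 + t \<le> exp t" by simp
    then have "q * (1 + t) \<le> 1" using mult_left_mono[of "1 + t" "exp t" q] q
      by (simp add: q_def flip: exp_add)
    then show ?thesis using q assms by (simp add: field_simps)
  qed
  have P: "(\<Sum>n\<in>K. exp (- t * (of_int n)\<^sup>2)) \<le> 1 / t" if K: "K \<subseteq> {0<..}" "finite K" for K
  proof -
    \<comment> \<open>One factor \<open>q\<close> is split off so that the exponents of the
      geometric series start at 0 when \<open>n\<close> starts at 1.\<close>
    have "(\<Sum>n\<in>K. exp (- t * (of_int n)\<^sup>2)) \<le> (\<Sum>n\<in>K. q * q ^ (nat n - 1))"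
    proof (rule sum_mono)
      fix n assume "n \<in> K"
      then have n: "n \<ge> 1" using K by force
      then have "real_of_int n \<le> (of_int n)\<^sup>2" by (simp add: power2_eq_square)
      moreover have "q * q ^ (nat n - 1) = exp (- t * of_int n)"
        using n by (simp add: q_def flip: exp_of_nat_mult exp_add) (simp add: of_nat_diff algebra_simps)
      ultimately show "exp (- t * (of_int n)\<^sup>2) \<le> q * q ^ (nat n - 1)"
        using assms by simp
    qed
    also have "\<dots> = (\<Sum>m\<in>(\<lambda>n. nat n - 1) ` K. q * q ^ m)"
    proof (rule sum.reindex_cong[symmetric, where l = "\<lambda>n. nat n - 1"])
      show "inj_on (\<lambda>n. nat n - 1) K"
      proof (rule inj_onI)
        fix m n assume "m \<in> K" "n \<in> K" "nat m - 1 = nat n - 1"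
        moreover have "m > 0" "n > 0" using calculation K by auto
        ultimately show "m = n" by linarith
      qed
    qed auto
    also have "\<dots> \<le> (\<Sum>m. q * q ^ m)"
      by (rule sum_le_suminf) (use q K in \<open>auto intro!: summable_mult summable_geometric\<close>)
    also have "\<dots> = q / (1 - q)" using q by (simp add: suminf_mult suminf_geometric summable_geometric)
    finally show ?thesis using qe by linarith
  qed
  have "(\<Sum>n\<in>J. exp (- t * (of_int n)\<^sup>2)) =
      (\<Sum>n\<in>J \<inter> {0}. exp (- t * (of_int n)\<^sup>2)) + (\<Sum>n\<in>J \<inter> {0<..}. exp (- t * (of_int n)\<^sup>2)) +
      (\<Sum>n\<in>J \<inter> {..<0}. exp (- t * (of_int n)\<^sup>2))"
  proof -
    have J: "J = J \<inter> {0} \<union> J \<inter> {0<..} \<union> J \<inter> {..<0}" by auto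
    show ?thesis
      using assms by (subst J, subst sum.union_disjoint, force, force, force,
        subst sum.union_disjoint) auto
  qed
  moreover have "(\<Sum>n\<in>J \<inter> {0}. exp (- t * (of_int n)\<^sup>2)) \<le> 1"
    by (cases "0 \<in> J") auto
  moreover have "(\<Sum>n\<in>J \<inter> {..<0}. exp (- t * (of_int n)\<^sup>2)) =
     (\<Sum>n\<in>uminus ` (J \<inter> {..<0}). exp (- t * (of_int n)\<^sup>2))"
    by (subst sum.reindex) auto
  moreover have "\<dots> \<le> 1 / t" by (rule P) (use assms in auto)
  moreover have "(\<Sum>n\<in>J \<inter> {0<..}. exp (- t * (of_int n)\<^sup>2)) \<le> 1 / t"
    by (rule P) (use assms in auto)
  ultimately show ?thesis by simp
qed

text \<open>Distinct elements have distinct integer coordinate vectors, so the sum is part of a sum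
  over a box, which factors into one-dimensional sums.\<close>

lemma sum_exp_neg_squares_le:
  fixes c :: "'a \<Rightarrow> 'i \<Rightarrow> real" and t :: real
  assumes "t > 0" "finite b" "finite F" "\<And>x i. x \<in> F \<Longrightarrow> i \<in> b \<Longrightarrow> c x i \<in> \<int>"
    and "\<And>x y. x \<in> F \<Longrightarrow> y \<in> F \<Longrightarrow> (\<And>i. i \<in> b \<Longrightarrow> c x i = c y i) \<Longrightarrow> x = y"
  shows "(\<Sum>x\<in>F. exp (- t * (\<Sum>i\<in>b. (c x i)\<^sup>2))) \<le> (1 + 2 / t) ^ card b"
proof -
  define r where "r x = (\<lambda>i\<in>b. \<lfloor>c x i\<rfloor>)" for x
  have r: "of_int (r x i) = c x i" if "x \<in> F" "i \<in> b" for x i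
    using assms(4)[OF that] that by (auto simp: r_def elim: Ints_cases)
  have inj: "inj_on r F"
    by (rule inj_onI, rule assms(5)) (auto simp flip: r)
  \<comment> \<open>\<open>J\<close> collects every coordinate value that occurs, so that the box
    over \<open>J\<close> contains all coordinate vectors.\<close>
  define J where "J = (\<Union>x\<in>F. r x ` b)"
  have fin: "finite J" using assms by (auto simp: J_def)
  have "(\<Sum>x\<in>F. exp (- t * (\<Sum>i\<in>b. (c x i)\<^sup>2))) =
      (\<Sum>g\<in>r ` F. \<Prod>i\<in>b. exp (- t * (of_int (g i))\<^sup>2))"
    by (subst sum.reindex[OF inj]) (auto simp: r sum_distrib_left exp_sum assms intro!: sum.cong prod.cong)
  also have "\<dots> \<le> (\<Sum>g\<in>PiE b (\<lambda>_. J). \<Prod>i\<in>b. exp (- t * (of_int (g i))\<^sup>2))"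
    by (rule sum_mono2) (use fin assms in \<open>auto intro!: finite_PiE prod_nonneg simp: J_def r_def\<close>)
  also have "\<dots> = (\<Prod>i\<in>b. \<Sum>n\<in>J. exp (- t * (of_int n)\<^sup>2))"
    by (subst prod_sum_PiE) (use fin assms in auto)
  also have "\<dots> \<le> (\<Prod>i\<in>b. 1 + 2 / t)"
    by (rule prod_mono) (use sum_exp_neg_square_le fin assms in \<open>auto intro!: sum_nonneg\<close>)
  finally show ?thesis by simp
qed

text \<open>The function \<open>h\<close> has only to dominate the sum of squared integer
  coordinates up to an affine change; the shift \<open>D\<close> costs the factor
  \<open>exp (t * D / C)\<close>. The explicit dependence on \<open>t\<close> is what the growth
  estimate at the cusps uses.\<close>

lemma exp_neg_form_summable:
  fixes c :: "'a \<Rightarrow> 'i \<Rightarrow> real" and t :: real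
  assumes "t > 0" "finite b" "\<And>x i. x \<in> S \<Longrightarrow> i \<in> b \<Longrightarrow> c x i \<in> \<int>"
    and "\<And>x y. x \<in> S \<Longrightarrow> y \<in> S \<Longrightarrow> (\<And>i. i \<in> b \<Longrightarrow> c x i = c y i) \<Longrightarrow> x = y"
    and "C > 0" "\<And>x. x \<in> S \<Longrightarrow> (\<Sum>i\<in>b. (c x i)\<^sup>2) \<le> D + C * h x"
  shows "(\<lambda>x. exp (- t * h x)) summable_on S"
    and "(\<Sum>\<^sub>\<infinity>x\<in>S. exp (- t * h x)) \<le> exp (t * D / C) * (1 + 2 * C / t) ^ card b"
proof -
  have *: "sum (\<lambda>x. exp (- t * h x)) F \<le> exp (t * D / C) * (1 + 2 * C / t) ^ card b"
    if F: "finite F" "F \<subseteq> S" for F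
  proof -
    have "sum (\<lambda>x. exp (- t * h x)) F \<le>
        (\<Sum>x\<in>F. exp (t * D / C) * exp (- (t / C) * (\<Sum>i\<in>b. (c x i)\<^sup>2)))"
    proof (rule sum_mono)
      fix x assume "x \<in> F"
      then have "(t / C) * (\<Sum>i\<in>b. (c x i)\<^sup>2) \<le> (t / C) * (D + C * h x)"
        using assms F by (intro mult_left_mono) auto
      then have "- t * h x \<le> t * D / C + - (t / C) * (\<Sum>i\<in>b. (c x i)\<^sup>2)"
        using assms by (simp add: field_simps)
      then show "exp (- t * h x) \<le> exp (t * D / C) * exp (- (t / C) * (\<Sum>i\<in>b. (c x i)\<^sup>2))"
        by (simp flip: exp_add)
    qed
    also have "\<dots> = exp (t * D / C) * (\<Sum>x\<in>F. exp (- (t / C) * (\<Sum>i\<in>b. (c x i)\<^sup>2)))"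
      by (simp add: sum_distrib_left)
    also have "\<dots> \<le> exp (t * D / C) * (1 + 2 / (t / C)) ^ card b"
    proof (intro mult_left_mono sum_exp_neg_squares_le)
      show "x = y" if "x \<in> F" "y \<in> F" "\<And>i. i \<in> b \<Longrightarrow> c x i = c y i" for x y
        using assms(4) that F by blast
    qed (use assms F in auto)
    finally show ?thesis using assms by simp
  qed
  show "(\<lambda>x. exp (- t * h x)) summable_on S"
    by (rule nonneg_bdd_above_summable_on, simp, rule bdd_aboveI2, rule *) auto
  then show "(\<Sum>\<^sub>\<infinity>x\<in>S. exp (- t * h x)) \<le> exp (t * D / C) * (1 + 2 * C / t) ^ card b"
    by (rule infsum_le_finite_sums) (use * in auto)
qed

section \<open>Definite subspaces and majorants\<close>

lemma e2pi_add: "e2pi (a + b) = e2pi a * e2pi b"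
  by (simp add: e2pi_def exp_add ring_distribs)

lemma e2pi_minus: "e2pi (- a) = inverse (e2pi a)"
  by (simp add: e2pi_def exp_minus)

lemma e2pi_0 [simp]: "e2pi 0 = 1"
  by (simp add: e2pi_def)

lemma e2pi_nonzero [simp]: "e2pi a \<noteq> 0"
  by (simp add: e2pi_def)

lemma norm_e2pi: "norm (e2pi a) = exp (- (2 * pi * Im a))"
  by (simp add: e2pi_def norm_exp_eq_Re)

lemma e2pi_of_int: "e2pi (of_int m) = 1"
  by (simp add: e2pi_def exp_eq_1)

lemma cvec_simps [simp]:
  "cvec (x + y) = cvec x + cvec y" "cvec (x - y) = cvec x - cvec y" "cvec 0 = 0"
  "vRe (cvec x) = x" "vIm (cvec x) = 0"
  "vRe (\<zeta> + \<xi>) = vRe \<zeta> + vRe \<xi>" "vIm (\<zeta> + \<xi>) = vIm \<zeta> + vIm \<xi>" "vRe 0 = 0" "vIm 0 = 0"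
  by (simp_all add: cvec_def vRe_def vIm_def vec_eq_iff)

lemma vRe_smult [simp]: "vRe (c *s \<zeta>) = Re c *\<^sub>R vRe \<zeta> - Im c *\<^sub>R vIm \<zeta>"
  and vIm_smult [simp]: "vIm (c *s \<zeta>) = Re c *\<^sub>R vIm \<zeta> + Im c *\<^sub>R vRe \<zeta>"
  by (simp_all add: vRe_def vIm_def vec_eq_iff)

lemma complexify_add: "subspace V \<Longrightarrow> \<zeta> \<in> complexify V \<Longrightarrow> \<xi> \<in> complexify V \<Longrightarrow> \<zeta> + \<xi> \<in> complexify V"
  by (simp add: complexify_def subspace_add)

lemma complexify_smult: "subspace V \<Longrightarrow> \<zeta> \<in> complexify V \<Longrightarrow> c *s \<zeta> \<in> complexify V"
  by (simp add: complexify_def subspace_add subspace_diff subspace_mul)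

lemma complexify_cvec: "subspace V \<Longrightarrow> x \<in> V \<Longrightarrow> cvec x \<in> complexify V"
  by (simp add: complexify_def subspace_0)

lemma complexify_mono: "V \<subseteq> W \<Longrightarrow> complexify V \<subseteq> complexify W"
  by (auto simp: complexify_def)

section \<open>Orthogonal projections and the majorant of a decomposition\<close>

locale sym_bilinear =
  fixes B :: "real ^ 'n \<Rightarrow> real ^ 'n \<Rightarrow> real"
  assumes bilin: "bilinear B" and form_sym: "B x y = B y x"
begin

lemma form_simps [simp]:
  "B (x + y) z = B x z + B y z" "B z (x + y) = B z x + B z y"
  "B (x - y) z = B x z - B y z" "B z (x - y) = B z x - B z y"
  "B (c *\<^sub>R x) z = c * B x z" "B z (c *\<^sub>R x) = c * B z x"
  "B 0 z = 0" "B z 0 = 0" "B (- x) z = - B x z" "B z (- x) = - B z x"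
  using bilin by (simp_all add: bilinear_ladd bilinear_radd bilinear_lsub bilinear_rsub
      bilinear_lmul bilinear_rmul bilinear_lzero bilinear_rzero bilinear_lneg bilinear_rneg)

lemma form_sum_left: "B (\<Sum>i\<in>I. f i) y = (\<Sum>i\<in>I. B (f i) y)"
  by (induction I rule: infinite_finite_induct) auto

lemma cform_simps:
  "cform B (\<zeta> + \<xi>) \<eta> = cform B \<zeta> \<eta> + cform B \<xi> \<eta>"
  "cform B \<eta> (\<zeta> + \<xi>) = cform B \<eta> \<zeta> + cform B \<eta> \<xi>"
  "cform B \<eta> (c *s \<zeta>) = c * cform B \<eta> \<zeta>"
  "cform B (cvec x) (cvec y) = of_real (B x y)"
  by (simp_all add: cform_def complex_eq_iff algebra_simps)

definition nondeg_on :: "(real ^ 'n) set \<Rightarrow> bool" where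
  "nondeg_on U \<longleftrightarrow> (\<forall>x\<in>U. (\<forall>y\<in>U. B x y = 0) \<longrightarrow> x = 0)"

text \<open>Two candidates for the projection differ by a vector of \<open>U\<close> orthogonal to
  \<open>U\<close>, so non-degeneracy makes the definite description in \<open>oproj\<close>
  unique.\<close>

lemma oproj_eqI:
  assumes "subspace U" "nondeg_on U" "y \<in> U" "\<And>z. z \<in> U \<Longrightarrow> B (x - y) z = 0"
  shows "oproj B U x = y"
  unfolding oproj_def
proof (rule the_equality)
  fix y' assume y': "y' \<in> U \<and> (\<forall>z\<in>U. B (x - y') z = 0)"
  have "B (y' - y) z = 0" if "z \<in> U" for z
    using y' assms(4)[OF that] that by simp
  then show "y' = y"
    using assms(1,2,3) y' subspace_diff[of U y' y] by (auto simp: nondeg_on_def)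
qed (use assms in auto)

lemma GrD:
  assumes "v \<in> Gr B V"
  shows "subspace (fst v)" "subspace (snd v)"
    "\<And>x. x \<in> fst v \<Longrightarrow> x \<noteq> 0 \<Longrightarrow> B x x > 0"
    "\<And>x. x \<in> snd v \<Longrightarrow> x \<noteq> 0 \<Longrightarrow> B x x < 0"
    "\<And>x y. x \<in> fst v \<Longrightarrow> y \<in> snd v \<Longrightarrow> B x y = 0"
    "\<And>x y. x \<in> snd v \<Longrightarrow> y \<in> fst v \<Longrightarrow> B x y = 0"
    "V = {x + y | x y. x \<in> fst v \<and> y \<in> snd v}"
proof -
  show "subspace (fst v)" "subspace (snd v)"
    "\<And>x. x \<in> fst v \<Longrightarrow> x \<noteq> 0 \<Longrightarrow> B x x > 0"
    "\<And>x. x \<in> snd v \<Longrightarrow> x \<noteq> 0 \<Longrightarrow> B x x < 0"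
    and orth: "\<And>x y. x \<in> fst v \<Longrightarrow> y \<in> snd v \<Longrightarrow> B x y = 0"
    using assms by (auto simp: Gr_def pos_def_on_def neg_def_on_def)
  show "\<And>x y. x \<in> snd v \<Longrightarrow> y \<in> fst v \<Longrightarrow> B x y = 0"
    using orth form_sym by metis
  show "V = {x + y | x y. x \<in> fst v \<and> y \<in> snd v}"
    using assms unfolding Gr_def by (cases v) simp
qed

lemma Gr_subset:
  assumes "v \<in> Gr B V"
  shows "fst v \<subseteq> V" "snd v \<subseteq> V"
proof -
  show "fst v \<subseteq> V" using GrD[OF assms] subspace_0[of "snd v"] by force
  show "snd v \<subseteq> V" using GrD[OF assms] subspace_0[of "fst v"] by force
qed

lemma Gr_decomp:
  assumes "v \<in> Gr B V" "x \<in> V"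
  obtains a c where "a \<in> fst v" "c \<in> snd v" "x = a + c"
  using GrD(7)[OF assms(1)] assms(2) by blast

text \<open>The extra summand \<open>m\<close>, orthogonal to \<open>V\<close>, allows projections
  to be computed for vectors outside \<open>V\<close>, such as the projections to \<open>w\<close>
  of vectors with a component in \<open>span M\<close>; \<open>m = 0\<close> gives the case inside
  \<open>V\<close>.\<close>

lemma oproj_Gr:
  assumes "v \<in> Gr B V" "a \<in> fst v" "c \<in> snd v" "\<And>z. z \<in> V \<Longrightarrow> B m z = 0"
  shows "oproj B (fst v) (m + (a + c)) = a" "oproj B (snd v) (m + (a + c)) = c"
proof -
  note G = GrD[OF assms(1)]
  have "nondeg_on (fst v)" "nondeg_on (snd v)"
    unfolding nondeg_on_def using G(3,4) by (metis less_irrefl)+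
  moreover have "B m z = 0" if "z \<in> fst v \<or> z \<in> snd v" for z
    using that Gr_subset[OF assms(1)] assms(4) by blast
  ultimately show "oproj B (fst v) (m + (a + c)) = a" "oproj B (snd v) (m + (a + c)) = c"
    using G assms by (auto intro!: oproj_eqI)
qed

lemma Gr_nondeg:
  assumes "v \<in> Gr B V"
  shows "nondeg_on V"
  unfolding nondeg_on_def
proof (intro ballI impI)
  fix x assume x: "x \<in> V" "\<forall>y\<in>V. B x y = 0"
  obtain a c where ac: "a \<in> fst v" "c \<in> snd v" "x = a + c"
    using Gr_decomp[OF assms x(1)] .
  have "B x a = 0" "B x c = 0" using x(2) Gr_subset[OF assms] ac by auto
  then have "B a a = 0" "B c c = 0" using GrD(5,6)[OF assms] ac by auto
  then show "x = 0" using GrD(3,4)[OF assms] ac by (metis add_0 less_irrefl)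
qed

text \<open>For \<open>v\<close> in \<open>Gr B V\<close> this is the classical majorant: the
  positive definite form on \<open>V\<close> obtained from \<open>B\<close> by reversing its sign on
  the negative part. It is the exponent in the absolute value of \<open>gauss_exp\<close>.\<close>

definition majorant :: "(real ^ 'n) set \<times> (real ^ 'n) set \<Rightarrow> real ^ 'n \<Rightarrow> real" where
  "majorant v x = B (oproj B (fst v) x) (oproj B (fst v) x) - B (oproj B (snd v) x) (oproj B (snd v) x)"

lemma norm_gauss_exp: "norm (gauss_exp B v \<tau> x) = exp (- (pi * Im \<tau>) * majorant v x)"
  by (simp add: gauss_exp_def norm_e2pi majorant_def algebra_simps)

text \<open>The sign \<open>s\<close> treats positive and negative definite subspaces together. The
  inequality is non-negativity of \<open>s * B z z\<close> for the component \<open>z\<close> of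
  \<open>x\<close> orthogonal to \<open>y\<close>.\<close>

lemma form_cauchy_schwarz:
  assumes "subspace U" "\<And>x. x \<in> U \<Longrightarrow> x \<noteq> 0 \<Longrightarrow> s * B x x > 0" "x \<in> U" "y \<in> U" "s\<^sup>2 = 1"
  shows "(B x y)\<^sup>2 \<le> (s * B x x) * (s * B y y)"
proof (cases "y = 0")
  case False
  define r where "r = B x y / B y y"
  define z where "z = x - r *\<^sub>R y"
  have y: "s * B y y > 0" using assms False by auto
  then have yy: "B y y \<noteq> 0" by auto
  have "z \<in> U" unfolding z_def using assms by (simp add: subspace_diff subspace_mul)
  then have "s * B z z \<ge> 0" using assms(2) by (cases "z = 0") (auto intro: less_imp_le)
  moreover have "B z z = B x x - (B x y)\<^sup>2 / B y y"
    unfolding z_def r_def using yy by (simp add: form_sym[of y x] field_simps power2_eq_square)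
  ultimately have "0 \<le> (s * B y y) * (s * (B x x - (B x y)\<^sup>2 / B y y))"
    using y by (metis less_imp_le mult_nonneg_nonneg)
  also have "\<dots> = (s * B x x) * (s * B y y) - s\<^sup>2 * (B x y)\<^sup>2"
    using yy by (simp add: field_simps power2_eq_square)
  finally show ?thesis using assms by simp
qed simp

lemma majorant_eq:
  assumes "v \<in> Gr B V" "a \<in> fst v" "c \<in> snd v" "\<And>z. z \<in> V \<Longrightarrow> B m z = 0"
  shows "majorant v (m + (a + c)) = B a a - B c c"
  using oproj_Gr[OF assms] by (simp add: majorant_def)

lemma majorant_nonneg:
  assumes "v \<in> Gr B V" "x \<in> V"
  shows "majorant v x \<ge> 0"
proof -
  obtain a c where ac: "a \<in> fst v" "c \<in> snd v" "x = a + c"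
    using Gr_decomp[OF assms] .
  have "B a a \<ge> 0" using GrD(3)[OF assms(1) ac(1)] by (cases "a = 0") auto
  moreover have "B c c \<le> 0" using GrD(4)[OF assms(1) ac(2)] by (cases "c = 0") auto
  ultimately show ?thesis using majorant_eq[OF assms(1) ac(1,2), of 0] ac by simp
qed

text \<open>Cauchy-Schwarz is applied on the positive and the negative part separately. The factor 2
  comes from bounding the square of a sum of two terms; it is not sharp, but only some constant
  matters.\<close>

lemma form_square_le_majorant:
  assumes "v \<in> Gr B V" "x \<in> V" "y \<in> V"
  shows "(B x y)\<^sup>2 \<le> 2 * majorant v x * majorant v y"
proof -
  obtain a c where ac: "a \<in> fst v" "c \<in> snd v" "x = a + c"
    using Gr_decomp[OF assms(1,2)] .
  obtain a' c' where ac': "a' \<in> fst v" "c' \<in> snd v" "y = a' + c'"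
    using Gr_decomp[OF assms(1,3)] .
  note G = GrD[OF assms(1)]
  have 1: "(B a a')\<^sup>2 \<le> B a a * B a' a'"
    using form_cauchy_schwarz[of "fst v" 1 a a'] G ac ac' by simp
  have 2: "(B c c')\<^sup>2 \<le> (- B c c) * (- B c' c')"
    using form_cauchy_schwarz[of "snd v" "-1" c c'] G ac ac' by simp
  have nn: "B a a \<ge> 0" "B a' a' \<ge> 0" "- B c c \<ge> 0" "- B c' c' \<ge> 0"
    using G(3,4) ac ac' by (metis form_simps(7) less_imp_le order_refl neg_0_le_iff_le)+
  have "B x y = B a a' + B c c'" using G(5,6) ac ac' by simp
  then have "(B x y)\<^sup>2 \<le> 2 * (B a a')\<^sup>2 + 2 * (B c c')\<^sup>2"
    using sum_squares_bound[of "B a a'" "B c c'"] by (simp add: power2_sum)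
  also have "\<dots> \<le> 2 * (B a a * B a' a') + 2 * ((- B c c) * (- B c' c'))"
    using 1 2 by simp
  also have "\<dots> \<le> 2 * (B a a - B c c) * (B a' a' - B c' c')"
    using mult_nonneg_nonneg[OF nn(1,4)] mult_nonneg_nonneg[OF nn(3,2)] by (simp add: algebra_simps)
  also have "\<dots> = 2 * majorant v x * majorant v y"
    using majorant_eq[OF assms(1) ac(1,2), of 0] majorant_eq[OF assms(1) ac'(1,2), of 0] ac ac' by simp
  finally show ?thesis .
qed

end

section \<open>Fourier series over the dual lattice\<close>

lemma has_sum_finite_sum:
  fixes f :: "'i \<Rightarrow> 'a \<Rightarrow> complex"
  assumes "finite I" "\<And>i. i \<in> I \<Longrightarrow> (f i has_sum s i) A"
  shows "((\<lambda>x. \<Sum>i\<in>I. f i x) has_sum (\<Sum>i\<in>I. s i)) A"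
  using assms by (induction I) (auto intro!: has_sum_add)

text \<open>Averaging over \<open>t = 0, 1/N, \<dots>, (N-1)/N\<close> leaves the frequencies divisible by \<open>N\<close>; then let \<open>N\<close>
  tend to infinity.\<close>

lemma has_sum_zero_frequency:
  fixes a :: "'a \<Rightarrow> complex" and c :: "'a \<Rightarrow> int"
  assumes "\<And>t::real. ((\<lambda>x. a x * e2pi (of_int (c x) * of_real t)) has_sum 0) S"
  shows "(a has_sum 0) {x\<in>S. c x = 0}"
proof -
  have a: "a summable_on S" using has_sum_imp_summable[OF assms[of 0]] by simp
  then have na: "(\<lambda>x. norm (a x)) summable_on S"
    using summable_on_iff_abs_summable_on_complex by blast
  define Z where "Z = {x\<in>S. c x = 0}"
  define R where "R N = {x\<in>S. c x \<noteq> 0 \<and> int N dvd c x}" for N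
  have aZ: "(a has_sum infsum a Z) Z"
    using summable_on_subset[OF a, of Z] by (auto simp: Z_def)
  have avg: "(a has_sum - infsum a Z) (R N)" if N: "N > 0" for N
  proof -
    have "((\<lambda>x. \<Sum>j<N. a x * e2pi (of_int (c x) * of_real (real j / real N))) has_sum (\<Sum>j<N. 0)) S"
      by (intro has_sum_finite_sum assms) simp
    moreover have "(\<Sum>j<N. a x * e2pi (of_int (c x) * of_real (real j / real N))) =
        (if int N dvd c x then of_nat N * a x else 0)" for x
    proof -
      define q where "q = e2pi (of_int (c x) / of_nat N)"
      have q: "e2pi (of_int (c x) * of_real (real j / real N)) = q ^ j" for j
        by (simp add: q_def e2pi_def flip: exp_of_nat_mult) (simp add: algebra_simps)
      have qN: "q ^ N = 1"
        using q[of N] N e2pi_of_int[of "c x"] by simp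
      have "(\<Sum>j<N. a x * e2pi (of_int (c x) * of_real (real j / real N))) = a x * (\<Sum>j<N. q ^ j)"
        unfolding q sum_distrib_left ..
      also have "\<dots> = (if int N dvd c x then of_nat N * a x else 0)"
      proof (cases "int N dvd c x")
        case True
        then obtain m where "c x = int N * m" by blast
        then have "q = 1" using N e2pi_of_int[of m] by (simp add: q_def)
        then show ?thesis using True by simp
      next
        case False
        have "q \<noteq> 1"
        proof
          assume "q = 1"
          then obtain m where "2 * pi * (c x / N) = 2 * of_int m * pi"
            by (auto simp: q_def e2pi_def exp_eq_1)
          then have "real_of_int (c x) = of_int (int N * m)"
            using N by (simp add: field_simps)
          then have "c x = int N * m" by linarith
          then show False using False by simp
        qed
        then show ?thesis using False qN by (simp add: geometric_sum)
      qed
      finally show ?thesis .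
    qed
    ultimately have "((\<lambda>x. if int N dvd c x then of_nat N * a x else 0) has_sum 0) S"
      by simp
    then have "((\<lambda>x. of_nat N * a x) has_sum 0) (Z \<union> R N)"
      by (rule has_sum_cong_neutral[THEN iffD1, rotated -1]) (auto simp: Z_def R_def)
    from has_sum_divide_const[OF this, of "of_nat N"] N
    have *: "(a has_sum 0) (Z \<union> R N)" by simp
    have "a summable_on R N" using a by (rule summable_on_subset) (auto simp: R_def)
    then have **: "(a has_sum infsum a (R N)) (R N)" by simp
    have "(a has_sum (infsum a Z + infsum a (R N))) (Z \<union> R N)"
      by (rule has_sum_Un_disjoint[OF aZ **]) (auto simp: Z_def R_def)
    with * have "infsum a Z + infsum a (R N) = 0" by (rule has_sum_unique[symmetric])
    then have "infsum a (R N) = - infsum a Z" by (simp add: eq_neg_iff_add_eq_0 add.commute)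
    then show ?thesis using ** by simp
  qed
  \<comment> \<open>By \<open>avg\<close> the sum over \<open>Z\<close> is minus the sum over
    \<open>R N\<close> for every positive \<open>N\<close>, and for large \<open>N\<close> the set
    \<open>R N\<close> avoids a finite set carrying all but \<open>e\<close> of the absolute
    sum.\<close>
  have "norm (infsum a Z) \<le> e" if e: "e > 0" for e
  proof -
    obtain F where F: "finite F" "F \<subseteq> S"
      "norm (sum (\<lambda>x. norm (a x)) F - infsum (\<lambda>x. norm (a x)) S) \<le> e"
      using infsum_finite_approximation[OF na e] by (auto simp: dist_norm)
    \<comment> \<open>This \<open>N\<close> exceeds the absolute value of every frequency on
      \<open>F\<close>, so no non-zero frequency there is divisible by \<open>N\<close>.\<close>
    define N where "N = Suc (\<Sum>x\<in>F. nat \<bar>c x\<bar>)"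
    have disj: "R N \<subseteq> S - F"
    proof
      fix x assume x: "x \<in> R N"
      have "x \<notin> F"
      proof
        assume "x \<in> F"
        then have "nat \<bar>c x\<bar> < N"
          using F(1) member_le_sum[of x F "\<lambda>x. nat \<bar>c x\<bar>"] by (simp add: N_def)
        then have "\<bar>c x\<bar> < int N" by linarith
        then show False using x zdvd_not_zless[of "\<bar>c x\<bar>" "int N"] by (auto simp: R_def)
      qed
      then show "x \<in> S - F" using x by (auto simp: R_def)
    qed
    have nR: "(\<lambda>x. norm (a x)) summable_on R N"
      using na by (rule summable_on_subset) (auto simp: R_def)
    have "norm (infsum a Z) = norm (infsum a (R N))"
      using infsumI[OF avg[of N]] by (simp add: N_def)
    also have "\<dots> \<le> infsum (\<lambda>x. norm (a x)) (R N)"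
      by (rule norm_infsum_bound[OF nR])
    also have "\<dots> \<le> infsum (\<lambda>x. norm (a x)) (S - F)"
      using disj by (intro infsum_mono2 nR summable_on_subset[OF na]) auto
    also have "\<dots> = infsum (\<lambda>x. norm (a x)) S - sum (\<lambda>x. norm (a x)) F"
      using F na by (subst infsum_Diff) (auto intro: summable_on_subset)
    also have "\<dots> \<le> e" using F(3) by simp
    finally show ?thesis .
  qed
  then have "infsum a Z = 0"
    by (metis field_le_epsilon add_0 norm_le_zero_iff)
  then show ?thesis using aZ by (simp add: Z_def)
qed

section \<open>Integral spans, cosets and the discriminant group\<close>

lemma int_spanI: "x = (\<Sum>i\<in>b. of_int (c i) *\<^sub>R i) \<Longrightarrow> x \<in> int_span b"
  by (auto simp: int_span_def)

lemma int_span_subset_span: "int_span b \<subseteq> span b"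
  by (auto simp: int_span_def intro!: span_sum intro: span_scale span_base)

lemma int_span_base:
  assumes "finite b" "x \<in> b"
  shows "x \<in> int_span b"
proof -
  have "x = (\<Sum>y\<in>b. of_int (if y = x then 1 else 0) *\<^sub>R y)"
    using assms by (simp add: if_distrib[of "\<lambda>c. of_int c *\<^sub>R _"] cong: if_cong)
  then show ?thesis by (rule int_spanI)
qed

lemma int_span_add:
  assumes "x \<in> int_span b" "y \<in> int_span b"
  shows "x + y \<in> int_span b"
proof -
  obtain c d where "x = (\<Sum>x\<in>b. of_int (c x) *\<^sub>R x)" "y = (\<Sum>x\<in>b. of_int (d x) *\<^sub>R x)"
    using assms by (auto simp: int_span_def)
  then have "x + y = (\<Sum>x\<in>b. of_int (c x + d x) *\<^sub>R x)"
    by (simp add: scaleR_add_left sum.distrib)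
  then show ?thesis by (rule int_spanI)
qed

lemma int_span_minus:
  assumes "x \<in> int_span b"
  shows "- x \<in> int_span b"
proof -
  obtain c where "x = (\<Sum>x\<in>b. of_int (c x) *\<^sub>R x)"
    using assms by (auto simp: int_span_def)
  then have "- x = (\<Sum>x\<in>b. of_int (- c x) *\<^sub>R x)"
    by (simp add: sum_negf)
  then show ?thesis by (rule int_spanI)
qed

lemma int_span_zero: "0 \<in> int_span b"
  by (rule int_spanI[where c = "\<lambda>_. 0"]) simp

lemma even_latticeE:
  assumes "even_lattice B L"
  obtains b where "finite b" "independent b" "L = int_span b" "span L = span b"
proof -
  obtain b where b: "finite b" "independent b" "L = int_span b"
    using assms by (auto simp: even_lattice_def)
  have "span L = span b"
    using b int_span_subset_span[of b] int_span_base[OF b(1)]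
    by (intro subset_antisym span_minimal) (auto intro: span_base)
  with b show ?thesis using that by blast
qed

lemma even_lattice_group:
  assumes "even_lattice B L"
  shows "0 \<in> L" "x \<in> L \<Longrightarrow> y \<in> L \<Longrightarrow> x + y \<in> L" "x \<in> L \<Longrightarrow> - x \<in> L"
    "x \<in> L \<Longrightarrow> y \<in> L \<Longrightarrow> x - y \<in> L"
  using even_latticeE[OF assms] int_span_add int_span_minus int_span_zero
  by (metis diff_conv_add_uminus)+

lemma coset_eq_iff:
  assumes "even_lattice B L"
  shows "coset L x = coset L y \<longleftrightarrow> x - y \<in> L"
proof
  assume "coset L x = coset L y"
  then have "x + 0 \<in> coset L y" using even_lattice_group(1)[OF assms] by (force simp: coset_def)
  then show "x - y \<in> L" by (auto simp: coset_def)
next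
  note g = even_lattice_group[OF assms]
  have *: "coset L x \<subseteq> coset L y" if "x - y \<in> L" for x y
  proof
    fix z assume "z \<in> coset L x"
    then obtain l where "l \<in> L" "z = x + l" by (auto simp: coset_def)
    then have "z = y + ((x - y) + l)" "(x - y) + l \<in> L" using g that by auto
    then show "z \<in> coset L y" unfolding coset_def by blast
  qed
  assume "x - y \<in> L"
  moreover have "y - x \<in> L" using g(3)[OF calculation] by simp
  ultimately show "coset L x = coset L y" using * by blast
qed

lemma mem_coset_iff:
  assumes "even_lattice B L"
  shows "y \<in> coset L x \<longleftrightarrow> coset L y = coset L x"
  unfolding coset_eq_iff[OF assms] by (force simp: coset_def)

lemma repr_coset:
  assumes "even_lattice B L"
  shows "coset L (repr (coset L x)) = coset L x"
  using someI[of "\<lambda>y. y \<in> coset L x" x] mem_coset_iff[OF assms] by (simp add: repr_def)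

text \<open>The classes are themselves sets of vectors, and they partition the dual lattice because
  it is stable under translation by \<open>L\<close>.\<close>

lemma disc_group_partition:
  assumes "even_lattice B L" "\<gamma> \<in> disc_group B L"
  shows "x \<in> \<gamma> \<longleftrightarrow> x \<in> dual_lattice B L \<and> coset L x = \<gamma>"
proof -
  obtain y where y: "y \<in> dual_lattice B L" "\<gamma> = coset L y"
    using assms(2) by (auto simp: disc_group_def)
  have "x \<in> dual_lattice B L" if x: "x \<in> coset L y"
  proof -
    obtain l where l: "l \<in> L" "x = y + l" using x unfolding coset_def by blast
    have "B l z \<in> \<int>" if "z \<in> L" for z
      using assms(1) l that by (auto simp: even_lattice_def)
    moreover have "bilinear B" using assms(1) by (simp add: even_lattice_def)
    ultimately show ?thesis
      using y l by (auto simp: dual_lattice_def span_add span_base bilinear_ladd)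
  qed
  then show ?thesis using mem_coset_iff[OF assms(1)] y by auto
qed

context sym_bilinear
begin

text \<open>The pairings with a spanning set \<open>b\<close> serve as coordinates: a vector
  orthogonal to \<open>b\<close> lies in the radical. On the dual lattice of the integral span of
  \<open>b\<close> these coordinates are integers.\<close>

lemma int_coords_eq:
  assumes "finite b" "span L = span b" "nondeg_on (span L)"
    and "x \<in> span L" "y \<in> span L" "\<And>i. i \<in> b \<Longrightarrow> B x i = B y i"
  shows "x = y"
proof -
  have "B (x - y) z = 0" if "z \<in> span b" for z
    using that by (induction rule: span_induct_alt) (simp_all add: assms(6))
  then show ?thesis
    using assms(2-5) span_diff[of x L y] unfolding nondeg_on_def by force
qed

text \<open>Every class has a representative in the fundamental parallelepiped of a basis. Its
  pairings with the basis are integers bounded by \<open>K\<close>, and they determine the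
  representative.\<close>

lemma finite_disc_group:
  assumes "even_lattice B L" "nondeg_on (span L)"
  shows "finite (disc_group B L)"
proof -
  obtain b where b: "finite b" "independent b" "L = int_span b" "span L = span b"
    using even_latticeE[OF assms(1)] .
  define K where "K = (\<Sum>i\<in>b. \<Sum>j\<in>b. \<bar>B i j\<bar>)"
  define E where "E = {y \<in> dual_lattice B L. \<forall>j\<in>b. \<bar>B y j\<bar> \<le> K}"
  have "finite E"
  proof (rule inj_on_finite)
    show "finite (PiE b (\<lambda>_. {r\<in>\<int>. \<bar>r\<bar> \<le> K}))"
      by (rule finite_PiE) (use b finite_abs_int_segment in auto)
    show "(\<lambda>y. \<lambda>j\<in>b. B y j) ` E \<subseteq> PiE b (\<lambda>_. {r\<in>\<int>. \<bar>r\<bar> \<le> K})"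
      using int_span_base[OF b(1)] b(3) by (auto simp: E_def dual_lattice_def)
    show "inj_on (\<lambda>y. \<lambda>j\<in>b. B y j) E"
    proof (rule inj_onI)
      fix x y assume xy: "x \<in> E" "y \<in> E" "(\<lambda>j\<in>b. B x j) = (\<lambda>j\<in>b. B y j)"
      have "B x j = B y j" if "j \<in> b" for j
        using fun_cong[OF xy(3), of j] that by simp
      then show "x = y"
        using xy by (intro int_coords_eq[OF b(1,4) assms(2)]) (auto simp: E_def dual_lattice_def)
    qed
  qed
  moreover have "disc_group B L \<subseteq> coset L ` E"
  proof
    fix \<gamma> assume "\<gamma> \<in> disc_group B L"
    then obtain x where x: "x \<in> dual_lattice B L" "\<gamma> = coset L x" by (auto simp: disc_group_def)
    then have "x \<in> span b" using b by (simp add: dual_lattice_def)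
    then obtain t where t: "x = (\<Sum>i\<in>b. t i *\<^sub>R i)"
      unfolding span_finite[OF b(1)] by auto
    \<comment> \<open>Subtracting the integral part of the coordinates of \<open>x\<close> leaves
      coordinates in [0,1), from which the bound \<open>K\<close> follows.\<close>
    define l where "l = (\<Sum>i\<in>b. of_int \<lfloor>t i\<rfloor> *\<^sub>R i)"
    have l: "l \<in> L" unfolding b(3) l_def by (rule int_spanI) simp
    have y: "x - l = (\<Sum>i\<in>b. frac (t i) *\<^sub>R i)"
      by (simp add: t l_def frac_def sum_subtractf scaleR_diff_left)
    have c: "coset L (x - l) = \<gamma>"
      using l even_lattice_group(3)[OF assms(1) l] by (simp add: x(2) coset_eq_iff[OF assms(1)])
    have "x - l \<in> \<gamma>" using c mem_coset_iff[OF assms(1), of "x - l" x] x by simp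
    then have "x - l \<in> dual_lattice B L"
      using disc_group_partition[OF assms(1) \<open>\<gamma> \<in> disc_group B L\<close>] by blast
    moreover have "\<bar>B (x - l) j\<bar> \<le> K" if j: "j \<in> b" for j
    proof -
      have "\<bar>B (x - l) j\<bar> \<le> (\<Sum>i\<in>b. \<bar>frac (t i) * B i j\<bar>)"
        unfolding y form_sum_left by (simp add: sum_abs)
      also have "\<dots> \<le> (\<Sum>i\<in>b. \<bar>B i j\<bar>)"
        by (intro sum_mono) (simp add: abs_mult frac_ge_0 frac_lt_1 less_imp_le mult_left_le_one_le)
      also have "\<dots> \<le> K" unfolding K_def
        by (intro sum_mono member_le_sum) (use j b in auto)
      finally show ?thesis .
    qed
    ultimately show "\<gamma> \<in> coset L ` E" using c by (auto simp: E_def)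
  qed
  ultimately show ?thesis using finite_surj by blast
qed

text \<open>After shifting the frequency \<open>x\<close> to zero, the frequencies with non-zero pairing with a basis vector
  of \<open>L\<close> are removed, one basis vector at a time.\<close>

lemma dual_fourier_unique:
  assumes "even_lattice B L" "nondeg_on (span L)"
    and "\<And>\<eta>. \<eta> \<in> span L \<Longrightarrow> ((\<lambda>x. a x * e2pi (of_real (B x \<eta>))) has_sum 0) (dual_lattice B L)"
    and "x \<in> dual_lattice B L"
  shows "a x = 0"
proof -
  obtain b where b: "finite b" "independent b" "L = int_span b" "span L = span b"
    using even_latticeE[OF assms(1)] .
  have step: "\<forall>\<eta>\<in>span L. ((\<lambda>y. a y * e2pi (of_real (B (y - x) \<eta>))) has_sum 0)
      {y \<in> dual_lattice B L. \<forall>i\<in>c. B (y - x) i = 0}" if "finite c" "c \<subseteq> b" for c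
    using that
  proof (induction c)
    case empty
    show ?case
    proof
      fix \<eta> assume "\<eta> \<in> span L"
      from has_sum_cmult_right[OF assms(3)[OF this], of "e2pi (of_real (- B x \<eta>))"]
      show "((\<lambda>y. a y * e2pi (of_real (B (y - x) \<eta>))) has_sum 0)
          {y \<in> dual_lattice B L. \<forall>i\<in>{}. B (y - x) i = 0}"
        by (simp add: mult_ac diff_conv_add_uminus e2pi_add del: add_uminus_conv_diff)
    qed
  next
    case (insert i c)
    let ?S = "{y \<in> dual_lattice B L. \<forall>i\<in>c. B (y - x) i = 0}"
    show ?case
    proof
      fix \<eta> assume \<eta>: "\<eta> \<in> span L"
      have i: "i \<in> L" using insert.prems int_span_base[OF b(1)] b(3) by auto
      have int: "of_int \<lfloor>B (y - x) i\<rfloor> = B (y - x) i" if "y \<in> ?S" for y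
        using that assms(4) i by (auto simp: dual_lattice_def elim!: Ints_cases)
      \<comment> \<open>Moving \<eta> by a real multiple \<open>t\<close> of the basis vector
        \<open>i\<close> multiplies the term at \<open>y\<close> by a character of \<open>t\<close>
        whose frequency is the integer \<open>B (y - x) i\<close>.\<close>
      have "((\<lambda>y. (a y * e2pi (of_real (B (y - x) \<eta>))) *
          e2pi (of_int \<lfloor>B (y - x) i\<rfloor> * of_real t)) has_sum 0) ?S" for t
      proof -
        have "\<eta> + t *\<^sub>R i \<in> span L" by (rule span_add[OF \<eta> span_scale[OF span_base[OF i]]])
        then have "((\<lambda>y. a y * e2pi (of_real (B (y - x) (\<eta> + t *\<^sub>R i)))) has_sum 0) ?S"
          using insert.IH insert.prems by blast
        then show ?thesis
        proof (rule has_sum_cong[THEN iffD1, rotated])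
          fix y assume "y \<in> ?S"
          from int[OF this] have eq: "(of_int \<lfloor>B (y - x) i\<rfloor> :: complex) = of_real (B (y - x) i)"
            by (metis of_real_of_int_eq)
          then show "a y * e2pi (of_real (B (y - x) (\<eta> + t *\<^sub>R i))) =
            (a y * e2pi (of_real (B (y - x) \<eta>))) * e2pi (of_int \<lfloor>B (y - x) i\<rfloor> * of_real t)"
            unfolding eq by (simp add: algebra_simps flip: e2pi_add)
        qed
      qed
      from has_sum_zero_frequency[OF this]
      have "((\<lambda>y. a y * e2pi (of_real (B (y - x) \<eta>))) has_sum 0) {y\<in>?S. \<lfloor>B (y - x) i\<rfloor> = 0}" .
      also have "{y\<in>?S. \<lfloor>B (y - x) i\<rfloor> = 0} = {y \<in> dual_lattice B L. \<forall>i\<in>insert i c. B (y - x) i = 0}"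
        using int by fastforce
      finally show "((\<lambda>y. a y * e2pi (of_real (B (y - x) \<eta>))) has_sum 0)
        {y \<in> dual_lattice B L. \<forall>i\<in>insert i c. B (y - x) i = 0}" .
    qed
  qed
  have "{y \<in> dual_lattice B L. \<forall>i\<in>b. B (y - x) i = 0} = {x}"
  proof -
    have "y = x" if "y \<in> dual_lattice B L" "\<forall>i\<in>b. B (y - x) i = 0" for y
      using that assms(4) by (intro int_coords_eq[OF b(1,4) assms(2)]) (auto simp: dual_lattice_def)
    then show ?thesis using assms(4) by auto
  qed
  then have "((\<lambda>y. a y * e2pi (of_real (B (y - x) 0))) has_sum 0) {x}"
    using step[OF b(1) order_refl] span_zero[of L] by fastforce
  then show ?thesis by (simp add: has_sum_finite_iff)
qed

end

section \<open>The decomposition along the sub-lattice\<close>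

lemma mob_simps:
  assumes "\<tau> \<in> uhp" "det A = 1"
  shows "autj A \<tau> \<noteq> 0" "Im (mob A \<tau>) = Im \<tau> / (norm (autj A \<tau>))\<^sup>2" "mob A \<tau> \<in> uhp"
proof -
  have det: "A $ 1 $ 1 * A $ 2 $ 2 - A $ 1 $ 2 * A $ 2 $ 1 = 1"
    using assms(2) by (simp add: det_2)
  show nz: "autj A \<tau> \<noteq> 0"
  proof
    assume 0: "autj A \<tau> = 0"
    then have "A $ 2 $ 1 * Im \<tau> = 0" "A $ 2 $ 1 * Re \<tau> + A $ 2 $ 2 = 0"
      by (auto simp: autj_def complex_eq_iff)
    then show False using assms det by (auto simp: uhp_def)
  qed
  have "Im (mob A \<tau>) = (A $ 1 $ 1 * A $ 2 $ 2 - A $ 1 $ 2 * A $ 2 $ 1) * Im \<tau> / (norm (autj A \<tau>))\<^sup>2"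
    by (simp add: mob_def moebius_def autj_def Im_divide cmod_power2 algebra_simps)
  then show Im: "Im (mob A \<tau>) = Im \<tau> / (norm (autj A \<tau>))\<^sup>2" using det by simp
  show "mob A \<tau> \<in> uhp" using assms nz by (simp add: uhp_def Im)
qed

text \<open>The new imaginary part is y divided by the squared absolute value of the automorphy
  factor. That square is at least 1 for y \<ge> 1 since the bottom row is integral and non-zero, and
  divided by y it grows at most linearly in y.\<close>

lemma SL2Z_Im_bounds:
  assumes "A \<in> SL2Z" "\<bar>x\<bar> \<le> R" "y \<ge> 1"
  shows "Im (mob A (Complex x y)) \<le> y" "Im (mob A (Complex x y)) > 0"
    "1 / Im (mob A (Complex x y)) \<le> (\<bar>A $ 2 $ 1\<bar> * R + \<bar>A $ 2 $ 2\<bar>)\<^sup>2 + (A $ 2 $ 1)\<^sup>2 * y"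
proof -
  define c d where "c = A $ 2 $ 1" and "d = A $ 2 $ 2"
  have det: "det A = 1" and "c \<in> \<int>" "d \<in> \<int>" using assms by (auto simp: SL2Z_def c_def d_def)
  then obtain m n where mn: "c = of_int m" "d = of_int n" by (auto elim!: Ints_cases)
  have uhp: "Complex x y \<in> uhp" using assms by (simp add: uhp_def)
  define N where "N = (norm (autj A (Complex x y)))\<^sup>2"
  have N: "N = (c * x + d)\<^sup>2 + (c * y)\<^sup>2"
    by (simp add: N_def autj_def cmod_power2 c_def d_def)
  have Im: "Im (mob A (Complex x y)) = y / N"
    using mob_simps(2)[OF uhp det] by (simp add: N_def)
  have sq: "(of_int k :: real)\<^sup>2 \<ge> 1" if "k \<noteq> 0" for k :: int
    using that by (metis of_int_1 of_int_le_iff of_int_power zero_less_power2 int_one_le_iff_zero_less)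
  have N1: "N \<ge> 1"
  proof (cases "m = 0")
    case True
    then have "n \<noteq> 0" using det mn by (auto simp: det_2 c_def d_def)
    then show ?thesis using sq[of n] True by (simp add: N mn)
  next
    case False
    have "1 * 1 \<le> c\<^sup>2 * y\<^sup>2"
      using sq[OF False] assms(3) by (intro mult_mono) (auto simp: mn)
    then show ?thesis by (simp add: N power_mult_distrib add_increasing)
  qed
  show "Im (mob A (Complex x y)) \<le> y" "Im (mob A (Complex x y)) > 0"
    using N1 assms(3) by (auto simp: Im field_simps mult_le_cancel_left1)
  have "\<bar>c * x + d\<bar> \<le> \<bar>c\<bar> * R + \<bar>d\<bar>"
    using mult_left_mono[OF assms(2), of "\<bar>c\<bar>"] by (simp flip: abs_mult)
  from power_mono[OF this, of 2] have "(c * x + d)\<^sup>2 \<le> (\<bar>c\<bar> * R + \<bar>d\<bar>)\<^sup>2" by simp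
  moreover have "(c * x + d)\<^sup>2 / y \<le> (c * x + d)\<^sup>2"
    using divide_left_mono[of 1 y "(c * x + d)\<^sup>2"] assms(3) by simp
  moreover have "1 / (y / N) = (c * x + d)\<^sup>2 / y + c\<^sup>2 * y"
    using assms(3) by (simp add: N field_simps power2_eq_square)
  ultimately show "1 / Im (mob A (Complex x y)) \<le> (\<bar>A $ 2 $ 1\<bar> * R + \<bar>A $ 2 $ 2\<bar>)\<^sup>2 + (A $ 2 $ 1)\<^sup>2 * y"
    by (simp add: Im c_def d_def)
qed

section \<open>Gaussian terms and convergence of the theta series\<close>

context sym_bilinear
begin

text \<open>Polarisation on the positive and the negative part produces the cross term. It matches
  the shift of \<zeta> in the quasi-periodicity of Jacobi forms.\<close>

lemma gauss_exp_add:
  assumes "v \<in> Gr B V" "x \<in> V" "y \<in> V"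
  shows "gauss_exp B v \<tau> (x + y) = gauss_exp B v \<tau> x * gauss_exp B v \<tau> y *
    e2pi (\<tau> * of_real (B x (oproj B (fst v) y)) + cnj \<tau> * of_real (B x (oproj B (snd v) y)))"
proof -
  obtain a c where ac: "a \<in> fst v" "c \<in> snd v" "x = a + c"
    using Gr_decomp[OF assms(1,2)] .
  obtain a' c' where ac': "a' \<in> fst v" "c' \<in> snd v" "y = a' + c'"
    using Gr_decomp[OF assms(1,3)] .
  note G = GrD[OF assms(1)]
  have s: "a + a' \<in> fst v" "c + c' \<in> snd v" using G(1,2) ac ac' by (simp_all add: subspace_add)
  have "x + y = (a + a') + (c + c')" using ac ac' by simp
  then show ?thesis
    using oproj_Gr[OF assms(1) ac(1,2), of 0] oproj_Gr[OF assms(1) ac'(1,2), of 0]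
      oproj_Gr[OF assms(1) s, of 0] G(5,6) ac ac'
    by (simp add: gauss_exp_def form_sym[of a' a] form_sym[of c' c] field_simps flip: e2pi_add)
qed

lemma oproj_Gr_mem:
  assumes "v \<in> Gr B V" "x \<in> V"
  shows "oproj B (fst v) x \<in> fst v" "oproj B (snd v) x \<in> snd v"
    "oproj B (fst v) x + oproj B (snd v) x = x"
proof -
  obtain a c where ac: "a \<in> fst v" "c \<in> snd v" "x = a + c"
    using Gr_decomp[OF assms] .
  then show "oproj B (fst v) x \<in> fst v" "oproj B (snd v) x \<in> snd v"
    "oproj B (fst v) x + oproj B (snd v) x = x"
    using oproj_Gr[OF assms(1) ac(1,2), of 0] by auto
qed

text \<open>The term linear in \<open>x\<close>, caused by the imaginary part of \<zeta>, is
  absorbed into half of the Gaussian decay; the remaining half is summable over the dual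
  lattice.\<close>

lemma theta_term_summable:
  assumes "even_lattice B L" "v \<in> Gr B (span L)" "\<tau> \<in> uhp" "\<zeta> \<in> complexify (span L)"
  shows "(\<lambda>x. gauss_exp B v \<tau> x * e2pi (cform B (cvec x) \<zeta>)) summable_on dual_lattice B L"
proof -
  obtain b where b: "finite b" "independent b" "L = int_span b" "span L = span b"
    using even_latticeE[OF assms(1)] .
  have bL: "i \<in> L" "i \<in> span L" if "i \<in> b" for i
    using int_span_base[OF b(1) that] b by (auto intro: span_base)
  define y where "y = Im \<tau>"
  define \<eta> where "\<eta> = vIm \<zeta>"
  define P where "P = majorant v \<eta>"
  \<comment> \<open>With this \<open>e\<close> one has \<open>2 * e * P \<le> y / 2\<close>, which
    is the half of the decay to be given up; the added 1 keeps the denominator positive when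
    \<open>P = 0\<close>.\<close>
  define e where "e = y / (4 * P + 1)"
  have y: "y > 0" using assms by (simp add: y_def uhp_def)
  have \<eta>: "\<eta> \<in> span L" using assms by (simp add: \<eta>_def complexify_def)
  have P: "P \<ge> 0" using majorant_nonneg[OF assms(2) \<eta>] by (simp add: P_def)
  have e: "e > 0" using y P by (simp add: e_def)
  have "(\<lambda>x. exp (- (pi * y / 2) * majorant v x)) summable_on dual_lattice B L"
  \<comment> \<open>The leading 1 makes the constant positive even for empty
    \<open>b\<close>.\<close>
  proof (rule exp_neg_form_summable(1)[of _ b _ "\<lambda>x i. B x i" "1 + (\<Sum>i\<in>b. 2 * majorant v i)" 0])
    show "x = x'" if "x \<in> dual_lattice B L" "x' \<in> dual_lattice B L" "\<And>i. i \<in> b \<Longrightarrow> B x i = B x' i"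
      for x x'
      using that Gr_nondeg[OF assms(2)] b by (intro int_coords_eq[of b L]) (auto simp: dual_lattice_def)
    show "(\<Sum>i\<in>b. (B x i)\<^sup>2) \<le> 0 + (1 + (\<Sum>i\<in>b. 2 * majorant v i)) * majorant v x"
      if "x \<in> dual_lattice B L" for x
    proof -
      have x: "x \<in> span L" using that by (simp add: dual_lattice_def)
      have "(\<Sum>i\<in>b. (B x i)\<^sup>2) \<le> (\<Sum>i\<in>b. 2 * majorant v x * majorant v i)"
        by (intro sum_mono form_square_le_majorant[OF assms(2) x] bL)
      also have "\<dots> = (\<Sum>i\<in>b. 2 * majorant v i) * majorant v x"
        by (simp add: sum_distrib_left sum_distrib_right mult_ac)
      finally show ?thesis using majorant_nonneg[OF assms(2) x] by (simp add: algebra_simps)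
    qed
    show "1 + (\<Sum>i\<in>b. 2 * majorant v i) > 0"
      by (intro add_pos_nonneg sum_nonneg mult_nonneg_nonneg majorant_nonneg[OF assms(2)] bL) auto
  qed (use y b bL in \<open>auto simp: dual_lattice_def\<close>)
  then have "(\<lambda>x. exp (pi / e) * exp (- (pi * y / 2) * majorant v x)) summable_on dual_lattice B L"
    by (rule summable_on_cmult_right)
  moreover have "norm (gauss_exp B v \<tau> x * e2pi (cform B (cvec x) \<zeta>)) \<le>
      exp (pi / e) * exp (- (pi * y / 2) * majorant v x)" if "x \<in> dual_lattice B L" for x
  proof -
    have x: "x \<in> span L" using that by (simp add: dual_lattice_def)
    define Q where "Q = majorant v x"
    have Q: "Q \<ge> 0" using majorant_nonneg[OF assms(2) x] by (simp add: Q_def)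
    define s where "s = B x \<eta>"
    \<comment> \<open>Completing the square trades the linear term \<open>- 2 * s\<close> for a
      small multiple of its square plus a constant.\<close>
    have "0 \<le> (e * s + 1)\<^sup>2 / e" using e by simp
    also have "\<dots> = e * s\<^sup>2 + 2 * s + 1 / e" using e by (simp add: field_simps power2_eq_square)
    finally have 1: "- 2 * s \<le> e * s\<^sup>2 + 1 / e" by simp
    have "e * s\<^sup>2 \<le> e * (2 * Q * P)"
      using form_square_le_majorant[OF assms(2) x \<eta>] e
      by (intro mult_left_mono) (auto simp: s_def Q_def P_def)
    also have "\<dots> \<le> y / 2 * Q"
      using P Q y by (simp add: e_def field_simps mult_left_mono)
    finally have "- 2 * s \<le> y / 2 * Q + 1 / e" using 1 by simp
    then have "pi * (- 2 * s) \<le> pi * (y / 2 * Q + 1 / e)"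
      by (intro mult_left_mono) auto
    then have "- (pi * y) * Q + - (2 * pi * s) \<le> pi / e + - (pi * y / 2) * Q"
      by (simp add: algebra_simps)
    moreover have "norm (gauss_exp B v \<tau> x * e2pi (cform B (cvec x) \<zeta>)) =
        exp (- (pi * y) * Q + - (2 * pi * s))"
      by (simp add: norm_mult norm_gauss_exp norm_e2pi y_def Q_def s_def cform_def \<eta>_def flip: exp_add)
    ultimately show ?thesis by (simp add: Q_def flip: exp_add)
  qed
  ultimately show ?thesis
    by (rule abs_summable_summable[OF Infinite_Sum.abs_summable_on_comparison_test'])
qed

end

section \<open>The orthogonal splitting of \<open>span L\<close> along \<open>span M\<close>\<close>

locale lattice_splitting = sym_bilinear +
  fixes L M and u w v
  assumes L: "even_lattice B L" and M: "even_lattice B M" and M_subset_L: "M \<subseteq> L"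
    and v: "v \<in> Gr B (span L)" and u: "u \<in> Gr B (span M)"
    and w: "w \<in> Gr B (orth_compl B L M)" and v_eq: "v = Gr_sum u w"
begin

abbreviation prM where "prM \<equiv> oproj B (span M)"

lemma span_M_subset: "span M \<subseteq> span L"
  by (rule span_mono[OF M_subset_L])

lemma orth_complD:
  assumes "z \<in> orth_compl B L M" "y \<in> span M"
  shows "B z y = 0" "B y z = 0"
  using assms form_sym[of z y] by (auto simp: orth_compl_def)

lemma subspace_orth_compl: "subspace (orth_compl B L M)"
  by (rule subspaceI) (auto simp: orth_compl_def span_zero span_add span_scale)

text \<open>The first bracket is the part in \<open>span M\<close> and the second its orthogonal
  complement; within each bracket the positive component comes first. All projections below are read
  off from these four components.\<close>

lemma decomp:
  assumes "x \<in> span L"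
  obtains p p' q q' where "p \<in> fst u" "p' \<in> snd u" "q \<in> fst w" "q' \<in> snd w"
    "x = (p + p') + (q + q')"
proof -
  obtain a c where ac: "a \<in> fst v" "c \<in> snd v" "x = a + c"
    using Gr_decomp[OF v assms] .
  then obtain p p' q q' where "p \<in> fst u" "q \<in> fst w" "a = p + q" "p' \<in> snd u" "q' \<in> snd w" "c = p' + q'"
    unfolding v_eq Gr_sum_def by auto
  then show ?thesis using that[of p p' q q'] ac by (simp add: add_ac)
qed

lemma prM_eqI:
  assumes "y \<in> span M" "x - y \<in> orth_compl B L M"
  shows "prM x = y"
  using oproj_eqI[OF subspace_span Gr_nondeg[OF u] assms(1)] orth_complD[OF assms(2)] by blast

text \<open>The formulas for \<open>w\<close> hold on all of \<open>span L\<close> because the part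
  in \<open>span M\<close> is orthogonal to the space decomposed by \<open>w\<close>.\<close>

lemma oproj_decomp:
  assumes "p \<in> fst u" "p' \<in> snd u" "q \<in> fst w" "q' \<in> snd w"
  shows "prM ((p + p') + (q + q')) = p + p'"
    "oproj B (fst u) (p + p') = p" "oproj B (snd u) (p + p') = p'"
    "oproj B (fst w) ((p + p') + (q + q')) = q" "oproj B (snd w) ((p + p') + (q + q')) = q'"
    "oproj B (fst v) ((p + p') + (q + q')) = p + q" "oproj B (snd v) ((p + p') + (q + q')) = p' + q'"
    "p \<in> span M" "p' \<in> span M" "q \<in> orth_compl B L M" "q' \<in> orth_compl B L M"
proof -
  show in_M: "p \<in> span M" "p' \<in> span M" using Gr_subset[OF u] assms by auto
  show in_o: "q \<in> orth_compl B L M" "q' \<in> orth_compl B L M" using Gr_subset[OF w] assms by auto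
  show "prM ((p + p') + (q + q')) = p + p'"
    by (rule prM_eqI) (use in_M in_o in \<open>auto intro: span_add subspace_add[OF subspace_orth_compl]\<close>)
  show "oproj B (fst u) (p + p') = p" "oproj B (snd u) (p + p') = p'"
    using oproj_Gr[OF u assms(1,2), of 0] by auto
  show "oproj B (fst w) ((p + p') + (q + q')) = q" "oproj B (snd w) ((p + p') + (q + q')) = q'"
    using oproj_Gr[OF w assms(3,4), of "p + p'"] orth_complD in_M by auto
  have "p + q \<in> fst v" "p' + q' \<in> snd v"
    using assms unfolding v_eq Gr_sum_def by auto
  from oproj_Gr[OF v this, of 0]
  show "oproj B (fst v) ((p + p') + (q + q')) = p + q"
    "oproj B (snd v) ((p + p') + (q + q')) = p' + q'"
    by (simp_all add: add_ac)
qed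

lemma prM:
  assumes "x \<in> span L"
  shows "prM x \<in> span M" "x - prM x \<in> orth_compl B L M"
proof -
  obtain p p' q q' where x: "p \<in> fst u" "p' \<in> snd u" "q \<in> fst w" "q' \<in> snd w"
    "x = (p + p') + (q + q')"
    using decomp[OF assms] .
  from oproj_decomp[OF x(1-4)]
  show "prM x \<in> span M" "x - prM x \<in> orth_compl B L M"
    by (auto simp: x(5) intro: span_add subspace_add[OF subspace_orth_compl])
qed

lemma prM_add:
  assumes "x \<in> span L" "y \<in> span M"
  shows "prM (x + y) = prM x + y"
  by (rule prM_eqI) (use prM[OF assms(1)] assms(2) in \<open>auto intro: span_add\<close>)

text \<open>A vector of \<open>span M\<close> has zero components in \<open>w\<close>. This is why
  the transformation laws of index \<open>(L, v)\<close> restrict to those of index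
  \<open>(M, u)\<close>.\<close>

lemma oproj_v_on_M:
  assumes "x \<in> span M"
  shows "oproj B (fst v) x = oproj B (fst u) x" "oproj B (snd v) x = oproj B (snd u) x"
    "oproj B (fst u) x \<in> span M" "oproj B (snd u) x \<in> span M"
proof -
  obtain p p' where x: "p \<in> fst u" "p' \<in> snd u" "x = p + p'"
    using Gr_decomp[OF u assms] .
  have "0 \<in> fst w" "0 \<in> snd w" using GrD(1,2)[OF w] by (auto simp: subspace_0)
  from oproj_decomp[OF x(1,2) this] x(3)
  show "oproj B (fst v) x = oproj B (fst u) x" "oproj B (snd v) x = oproj B (snd u) x"
    "oproj B (fst u) x \<in> span M" "oproj B (snd u) x \<in> span M"
    by auto
qed

text \<open>The positive components in \<open>u\<close> and \<open>w\<close> are orthogonal, as are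
  the negative ones, so squares add and the exponential factors.\<close>

lemma gauss_exp_split:
  assumes "x \<in> span L"
  shows "gauss_exp B v \<tau> x = gauss_exp B u \<tau> (prM x) * gauss_exp B w \<tau> x"
proof -
  obtain p p' q q' where x: "p \<in> fst u" "p' \<in> snd u" "q \<in> fst w" "q' \<in> snd w"
    "x = (p + p') + (q + q')"
    using decomp[OF assms] .
  note o = oproj_decomp[OF x(1-4)]
  have "B p q = 0" "B q p = 0" "B p' q' = 0" "B q' p' = 0"
    using orth_complD o(8-11) by auto
  then show ?thesis
    unfolding gauss_exp_def x(5) o(1-7) e2pi_add[symmetric]
    by (intro arg_cong[where f = e2pi]) (simp add: field_simps)
qed

text \<open>Invariance under \<open>span M\<close> makes the Gaussian of \<open>w\<close> well
  defined on cosets of \<open>M\<close>.\<close>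

lemma oproj_w_add:
  assumes "x \<in> span L" "m \<in> span M"
  shows "oproj B (fst w) (x + m) = oproj B (fst w) x" "oproj B (snd w) (x + m) = oproj B (snd w) x"
proof -
  obtain p p' q q' where x: "p \<in> fst u" "p' \<in> snd u" "q \<in> fst w" "q' \<in> snd w"
    "x = (p + p') + (q + q')"
    using decomp[OF assms(1)] .
  have *: "x + m = (p + p' + m) + (q + q')" using x by simp
  moreover have "B (p + p' + m) z = 0" if "z \<in> orth_compl B L M" for z
    using orth_complD[OF that] assms oproj_decomp(8,9)[OF x(1-4)] by simp
  ultimately show "oproj B (fst w) (x + m) = oproj B (fst w) x" "oproj B (snd w) (x + m) = oproj B (snd w) x"
    using oproj_Gr[OF w x(3,4), of "p + p' + m"] oproj_decomp(4,5)[OF x(1-4)]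
    unfolding * x(5) by metis+
qed

lemma form_prM:
  assumes "x \<in> span L" "y \<in> span M"
  shows "B (prM x) y = B x y"
  using orth_complD(1)[OF prM(2)[OF assms(1)] assms(2)] by simp

lemma cform_prM:
  assumes "x \<in> span L" "\<xi> \<in> complexify (span M)"
  shows "cform B (cvec (prM x)) \<xi> = cform B (cvec x) \<xi>"
  using form_prM[OF assms(1)] assms(2) by (simp add: cform_def complexify_def)

lemma prM_dual:
  assumes "x \<in> dual_lattice B L"
  shows "prM x \<in> dual_lattice B M"
  using assms prM(1)[of x] form_prM[of x] M_subset_L by (auto simp: dual_lattice_def span_base)

text \<open>For \<open>x\<close> above \<mu>, the pairing with a basis vector \<open>i\<close> of
  \<open>L\<close> is \<open>B \<mu> i\<close> plus the pairing of \<open>x - \<mu>\<close> with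
  \<open>i - prM i\<close>. The first term is constant on the fiber and gives \<open>D\<close>; the
  second is controlled by the majorant of \<open>w\<close> and gives \<open>C\<close>. Neither
  constant depends on \<open>t\<close>.\<close>

lemma fiber_gauss_bound:
  assumes "\<mu> \<in> span M"
  shows "\<exists>C D :: real. \<exists>n :: nat. C > 0 \<and> D \<ge> 0 \<and> (\<forall>t>0.
    (\<lambda>x. exp (- t * majorant w x)) summable_on {x \<in> dual_lattice B L. prM x = \<mu>} \<and>
    (\<Sum>\<^sub>\<infinity>x\<in>{x \<in> dual_lattice B L. prM x = \<mu>}. exp (- t * majorant w x)) \<le>
      exp (t * D / C) * (1 + 2 * C / t) ^ n)"
proof -
  let ?S = "{x \<in> dual_lattice B L. prM x = \<mu>}"
  obtain b where b: "finite b" "independent b" "L = int_span b" "span L = span b"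
    using even_latticeE[OF L] .
  have bL: "i \<in> L" "i \<in> span L" if "i \<in> b" for i
    using int_span_base[OF b(1) that] b by (auto intro: span_base)
  define D where "D = (\<Sum>i\<in>b. 2 * (B \<mu> i)\<^sup>2)"
  define C where "C = 1 + (\<Sum>i\<in>b. 4 * majorant w (i - prM i))"
  have C: "C > 0" unfolding C_def
    by (intro add_pos_nonneg sum_nonneg mult_nonneg_nonneg majorant_nonneg[OF w] prM(2) bL) auto
  have D: "D \<ge> 0" unfolding D_def by (intro sum_nonneg) auto
  have 1: "(\<Sum>i\<in>b. (B x i)\<^sup>2) \<le> D + C * majorant w x" if x: "x \<in> ?S" for x
  proof -
    have xL: "x \<in> span L" using x by (simp add: dual_lattice_def)
    have o: "x - \<mu> \<in> orth_compl B L M" using prM(2)[OF xL] x by simp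
    have m: "majorant w (x - \<mu>) = majorant w x"
      using oproj_w_add[OF xL, of "- \<mu>"] assms by (simp add: majorant_def span_neg)
    have nn: "majorant w x \<ge> 0" using majorant_nonneg[OF w o] m by simp
    have "(B x i)\<^sup>2 \<le> 2 * (B \<mu> i)\<^sup>2 + 4 * majorant w (i - prM i) * majorant w x" if i: "i \<in> b" for i
    proof -
      have "B x i = B \<mu> i + B (x - \<mu>) (i - prM i)"
        using orth_complD(1)[OF o prM(1)[OF bL(2)[OF i]]] by simp
      then have "(B x i)\<^sup>2 \<le> 2 * (B \<mu> i)\<^sup>2 + 2 * (B (x - \<mu>) (i - prM i))\<^sup>2"
        using sum_squares_bound[of "B \<mu> i" "B (x - \<mu>) (i - prM i)"] by (simp only: power2_sum)
      also have "(B (x - \<mu>) (i - prM i))\<^sup>2 \<le> 2 * majorant w (x - \<mu>) * majorant w (i - prM i)"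
        by (rule form_square_le_majorant[OF w o prM(2)[OF bL(2)[OF i]]])
      finally show ?thesis by (simp add: m mult_ac)
    qed
    then have "(\<Sum>i\<in>b. (B x i)\<^sup>2) \<le> (\<Sum>i\<in>b. 2 * (B \<mu> i)\<^sup>2 + 4 * majorant w (i - prM i) * majorant w x)"
      by (rule sum_mono)
    also have "\<dots> = D + (\<Sum>i\<in>b. 4 * majorant w (i - prM i)) * majorant w x"
      by (simp add: D_def sum.distrib sum_distrib_right)
    finally show ?thesis using nn by (simp add: C_def ring_distribs)
  qed
  have 2: "x = x'" if "x \<in> ?S" "x' \<in> ?S" "\<And>i. i \<in> b \<Longrightarrow> B x i = B x' i" for x x'
    using that Gr_nondeg[OF v] b by (intro int_coords_eq[of b L]) (auto simp: dual_lattice_def)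
  have 3: "B x i \<in> \<int>" if "x \<in> ?S" "i \<in> b" for x i
    using that bL by (auto simp: dual_lattice_def)
  show ?thesis
    by (rule exI[of _ C], rule exI[of _ D], rule exI[of _ "card b"],
        intro conjI allI impI C D exp_neg_form_summable[OF _ b(1) 3 2 C 1])
qed

end

section \<open>Restriction of Jacobi forms\<close>

lemma gauss_exp_nonzero [simp]: "gauss_exp B v \<tau> x \<noteq> 0"
  by (simp add: gauss_exp_def)

section \<open>Periodicity and uniform growth of Fourier coefficients\<close>

text \<open>Quasi-periodicity under \<sigma> together with an index shift by \<sigma> gives a second
  expansion of the same function, with coefficients translated by \<sigma>. Uniqueness of Fourier
  coefficients, tested at real arguments only, identifies the two families.\<close>

lemma jacobi_form_coefficients_periodic:
  assumes "even_lattice B L" "v \<in> Gr B (span L)" "jacobi_form k l B L v \<Gamma> \<Phi>"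
    and f: "\<And>\<zeta>. \<zeta> \<in> complexify (span L) \<Longrightarrow>
       ((\<lambda>x. f x * (gauss_exp B v \<tau> x * e2pi (cform B (cvec x) \<zeta>))) has_sum \<Phi> (\<tau>, \<zeta>)) (dual_lattice B L)"
    and \<tau>: "\<tau> \<in> uhp" and x: "x \<in> dual_lattice B L" and \<sigma>: "\<sigma> \<in> L"
  shows "f (x + \<sigma>) = f x"
proof -
  interpret sym_bilinear B
    by standard (use assms(1) in \<open>auto simp: even_lattice_def\<close>)
  note grp = even_lattice_group[OF assms(1)]
  have dual: "y + \<sigma>' \<in> dual_lattice B L" if "y \<in> dual_lattice B L" "\<sigma>' \<in> L" for y \<sigma>'
    using that assms(1) by (auto simp: dual_lattice_def even_lattice_def span_add span_base)
  define g where "g y = gauss_exp B v \<tau> y" for y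
  define \<sigma>p \<sigma>m where "\<sigma>p = oproj B (fst v) \<sigma>" and "\<sigma>m = oproj B (snd v) \<sigma>"
  have \<sigma>L: "\<sigma> \<in> span L" using \<sigma> by (rule span_base)
  have mem: "\<sigma>p \<in> span L" "\<sigma>m \<in> span L"
    using oproj_Gr_mem[OF assms(2) \<sigma>L] Gr_subset[OF assms(2)] by (auto simp: \<sigma>p_def \<sigma>m_def)
  \<comment> \<open>The factor of automorphy is the inverse of the theta term at \<sigma>.\<close>
  have e_neg: "e2pi (- \<tau> * of_real (B \<sigma>p \<sigma>p) / 2 - cnj \<tau> * of_real (B \<sigma>m \<sigma>m) / 2 - cform B (cvec \<sigma>) \<zeta>)
    = inverse (g \<sigma> * e2pi (cform B (cvec \<sigma>) \<zeta>))" for \<zeta>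
    unfolding g_def gauss_exp_def \<sigma>p_def[symmetric] \<sigma>m_def[symmetric]
    by (simp flip: e2pi_add e2pi_minus)
  \<comment> \<open>The difference of the two coefficient families, with the non-zero Gaussian
    factor included; its vanishing at \<open>x + \<sigma>\<close> is the claim.\<close>
  define a where "a y = (f (y - \<sigma>) - f y) * g y" for y
  have "a (x + \<sigma>) = 0"
  proof (rule dual_fourier_unique[OF assms(1) Gr_nondeg[OF assms(2)] _ dual[OF x \<sigma>]])
    fix \<eta> assume \<eta>: "\<eta> \<in> span L"
    define \<zeta> where "\<zeta> = cvec \<eta>"
    \<comment> \<open>The summand \<open>cvec 0\<close> is the translation by \<nu> = 0 and gives
      the argument the form used in \<open>jacobi_form_def\<close>.\<close>
    define \<zeta>' where "\<zeta>' = \<zeta> + \<tau> *s cvec \<sigma>p + cnj \<tau> *s cvec \<sigma>m + cvec 0"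
    have \<zeta>: "\<zeta> \<in> complexify (span L)" "\<zeta>' \<in> complexify (span L)"
      unfolding \<zeta>_def \<zeta>'_def using \<eta> mem
      by (auto intro!: complexify_add complexify_smult complexify_cvec span_zero)
    have "\<Phi> (\<tau>, \<zeta>') = inverse (g \<sigma> * e2pi (cform B (cvec \<sigma>) \<zeta>)) * \<Phi> (\<tau>, \<zeta>)"
      using assms(3) \<tau> \<zeta>(1) \<sigma> grp(1) unfolding jacobi_form_def \<zeta>'_def \<sigma>p_def \<sigma>m_def
      by (simp only: e_neg[unfolded \<sigma>p_def \<sigma>m_def])
    then have \<Phi>: "(g \<sigma> * e2pi (cform B (cvec \<sigma>) \<zeta>)) * \<Phi> (\<tau>, \<zeta>') = \<Phi> (\<tau>, \<zeta>)"
      by (simp add: g_def field_simps)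
    have "((\<lambda>y. (g \<sigma> * e2pi (cform B (cvec \<sigma>) \<zeta>)) *
        (f y * (g y * e2pi (cform B (cvec y) \<zeta>')))) has_sum \<Phi> (\<tau>, \<zeta>)) (dual_lattice B L)"
      using has_sum_cmult_right[OF f[OF \<zeta>(2)], of "g \<sigma> * e2pi (cform B (cvec \<sigma>) \<zeta>)"]
      unfolding g_def[symmetric] \<Phi> .
    \<comment> \<open>Replacing \<open>y\<close> by \<open>y + \<sigma>\<close> produces exactly the
      Gaussian cross term that the shift from \<zeta> to \<open>\<zeta>'\<close> contributes through
      its pairing with \<open>y\<close>.\<close>
    also have "?this \<longleftrightarrow> ((\<lambda>y. f (y - \<sigma>) * (g y * e2pi (of_real (B y \<eta>)))) has_sum \<Phi> (\<tau>, \<zeta>))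
        (dual_lattice B L)"
    proof (rule has_sum_reindex_bij_witness[of _ "\<lambda>y. y - \<sigma>" "\<lambda>y. y + \<sigma>"])
      show "y - \<sigma> \<in> dual_lattice B L" if "y \<in> dual_lattice B L" for y
        using dual[OF that grp(3)[OF \<sigma>]] by simp
      fix y assume y: "y \<in> dual_lattice B L"
      have g: "g (y + \<sigma>) = g y * g \<sigma> * e2pi (\<tau> * of_real (B y \<sigma>p) + cnj \<tau> * of_real (B y \<sigma>m))"
        unfolding g_def \<sigma>p_def \<sigma>m_def
        by (rule gauss_exp_add[OF assms(2) _ \<sigma>L]) (use y in \<open>simp add: dual_lattice_def\<close>)
      have "cform B (cvec y) \<zeta>' = of_real (B y \<eta>) + (\<tau> * of_real (B y \<sigma>p) + cnj \<tau> * of_real (B y \<sigma>m))"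
        unfolding \<zeta>'_def \<zeta>_def cform_simps by simp
      then show "f (y + \<sigma> - \<sigma>) * (g (y + \<sigma>) * e2pi (of_real (B (y + \<sigma>) \<eta>))) =
        (g \<sigma> * e2pi (cform B (cvec \<sigma>) \<zeta>)) * (f y * (g y * e2pi (cform B (cvec y) \<zeta>')))"
        unfolding g by (simp add: \<zeta>_def cform_simps e2pi_add mult_ac)
    qed (use dual \<sigma> in auto)
    finally have 1: "((\<lambda>y. f (y - \<sigma>) * (g y * e2pi (of_real (B y \<eta>)))) has_sum \<Phi> (\<tau>, \<zeta>))
        (dual_lattice B L)" .
    have "((\<lambda>y. f y * (g y * e2pi (of_real (B y \<eta>)))) has_sum \<Phi> (\<tau>, \<zeta>)) (dual_lattice B L)"
      using f[OF \<zeta>(1)] by (simp add: g_def \<zeta>_def cform_simps)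
    from has_sum_add[OF 1 has_sum_uminusI[OF this]]
    show "((\<lambda>y. a y * e2pi (of_real (B y \<eta>))) has_sum 0) (dual_lattice B L)"
      by (simp add: a_def algebra_simps)
  qed
  then show ?thesis by (simp add: a_def g_def)
qed

text \<open>By periodicity only one coefficient function for each of the finitely many classes
  occurs, so the constants can be chosen independently of \<open>x\<close>. The bound
  \<open>K \<ge> 0\<close> permits multiplication of inequalities later.\<close>

lemma (in sym_bilinear) uniform_lin_exp_growth:
  assumes "even_lattice B L" "nondeg_on (span L)"
    and growth: "\<And>x. x \<in> dual_lattice B L \<Longrightarrow> lin_exp_growth (f x)"
    and periodic: "\<And>x \<sigma> \<tau>. x \<in> dual_lattice B L \<Longrightarrow> \<sigma> \<in> L \<Longrightarrow> \<tau> \<in> uhp \<Longrightarrow> f (x + \<sigma>) \<tau> = f x \<tau>"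
    and A: "A \<in> SL2Z"
  shows "\<exists>C :: real. \<forall>X :: real set. bounded X \<longrightarrow> (\<exists>K\<ge>0. \<exists>Y.
    \<forall>x\<in>dual_lattice B L. \<forall>r\<in>X. \<forall>y>0. y \<ge> Y \<longrightarrow> norm (f x (mob A (Complex r y))) \<le> K * exp (C * y))"
proof -
  define D where "D = disc_group B L"
  have fin: "finite D" unfolding D_def by (rule finite_disc_group[OF assms(1,2)])
  have mem: "x \<in> \<gamma> \<longleftrightarrow> x \<in> dual_lattice B L \<and> coset L x = \<gamma>" if "\<gamma> \<in> D" for x \<gamma>
    using disc_group_partition[OF assms(1)] that by (simp add: D_def)
  have repr: "repr \<gamma> \<in> dual_lattice B L" "coset L (repr \<gamma>) = \<gamma>" if "\<gamma> \<in> D" for \<gamma>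
  proof -
    have "\<gamma> \<noteq> {}" using that even_lattice_group(1)[OF assms(1)] by (auto simp: D_def disc_group_def coset_def)
    then have "repr \<gamma> \<in> \<gamma>" unfolding repr_def by (metis ex_in_conv someI)
    then show "repr \<gamma> \<in> dual_lattice B L" "coset L (repr \<gamma>) = \<gamma>" using mem[OF that] by auto
  qed
  have "\<forall>\<gamma>\<in>D. \<exists>C. \<forall>X. bounded X \<longrightarrow> (\<exists>K Y. \<forall>r\<in>X. \<forall>y>0. y \<ge> Y \<longrightarrow>
      norm (f (repr \<gamma>) (mob A (Complex r y))) \<le> K * exp (C * y))"
    using growth[OF repr(1)] A unfolding lin_exp_growth_def by blast
  from bchoice[OF this] obtain C where C: "\<forall>\<gamma>\<in>D. \<forall>X. bounded X \<longrightarrow> (\<exists>K Y. \<forall>r\<in>X. \<forall>y>0. y \<ge> Y \<longrightarrow>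
      norm (f (repr \<gamma>) (mob A (Complex r y))) \<le> K * exp (C \<gamma> * y))" by blast
  show ?thesis
  \<comment> \<open>A sum of absolute values dominates each of its terms. The exponent is fixed
    before \<open>X\<close>, as the quantifiers in \<open>lin_exp_growth\<close> demand.\<close>
  proof (rule exI[of _ "\<Sum>\<gamma>\<in>D. \<bar>C \<gamma>\<bar>"], intro allI impI)
    fix X :: "real set" assume X: "bounded X"
    then have "\<forall>\<gamma>\<in>D. \<exists>K Y. \<forall>r\<in>X. \<forall>y>0. y \<ge> Y \<longrightarrow>
        norm (f (repr \<gamma>) (mob A (Complex r y))) \<le> K * exp (C \<gamma> * y)" using C by blast
    from bchoice[OF this] obtain K where "\<forall>\<gamma>\<in>D. \<exists>Y. \<forall>r\<in>X. \<forall>y>0. y \<ge> Y \<longrightarrow>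
        norm (f (repr \<gamma>) (mob A (Complex r y))) \<le> K \<gamma> * exp (C \<gamma> * y)" by blast
    from bchoice[OF this] obtain Y where Y: "\<forall>\<gamma>\<in>D. \<forall>r\<in>X. \<forall>y>0. y \<ge> Y \<gamma> \<longrightarrow>
        norm (f (repr \<gamma>) (mob A (Complex r y))) \<le> K \<gamma> * exp (C \<gamma> * y)" by blast
    have le: "h \<gamma> \<le> (\<Sum>\<gamma>\<in>D. \<bar>h \<gamma>\<bar>)" if "\<gamma> \<in> D" for h :: "_ \<Rightarrow> real" and \<gamma>
      using member_le_sum[OF that, of "\<lambda>\<gamma>. \<bar>h \<gamma>\<bar>"] fin by simp
    show "\<exists>K'\<ge>0. \<exists>Y'. \<forall>x\<in>dual_lattice B L. \<forall>r\<in>X. \<forall>y>0. y \<ge> Y' \<longrightarrow>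
      norm (f x (mob A (Complex r y))) \<le> K' * exp ((\<Sum>\<gamma>\<in>D. \<bar>C \<gamma>\<bar>) * y)"
    proof (intro exI conjI ballI allI impI)
      show "(\<Sum>\<gamma>\<in>D. \<bar>K \<gamma>\<bar>) \<ge> 0" by (rule sum_nonneg) auto
      fix x r and y :: real
      assume x: "x \<in> dual_lattice B L" and r: "r \<in> X" and y: "y > 0" "y \<ge> (\<Sum>\<gamma>\<in>D. \<bar>Y \<gamma>\<bar>)"
      define \<gamma> where "\<gamma> = coset L x"
      have \<gamma>: "\<gamma> \<in> D" using x by (auto simp: \<gamma>_def D_def disc_group_def)
      have "x - repr \<gamma> \<in> L" using repr(2)[OF \<gamma>] coset_eq_iff[OF assms(1)] by (metis \<gamma>_def)
      moreover have "mob A (Complex r y) \<in> uhp"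
        by (rule mob_simps(3)) (use y A in \<open>auto simp: uhp_def SL2Z_def\<close>)
      ultimately have "f x (mob A (Complex r y)) = f (repr \<gamma>) (mob A (Complex r y))"
        using periodic[OF repr(1)[OF \<gamma>], of "x - repr \<gamma>"] by simp
      also have "norm \<dots> \<le> K \<gamma> * exp (C \<gamma> * y)"
        using Y \<gamma> r y le[OF \<gamma>, of Y] by auto
      also have "\<dots> \<le> (\<Sum>\<gamma>\<in>D. \<bar>K \<gamma>\<bar>) * exp ((\<Sum>\<gamma>\<in>D. \<bar>C \<gamma>\<bar>) * y)"
        by (intro mult_mono le \<gamma> sum_nonneg) (use le[OF \<gamma>, of C] y in auto)
      finally show "norm (f x (mob A (Complex r y))) \<le> (\<Sum>\<gamma>\<in>D. \<bar>K \<gamma>\<bar>) * exp ((\<Sum>\<gamma>\<in>D. \<bar>C \<gamma>\<bar>) * y)" .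
    qed
  qed
qed

section \<open>Fiber sums and the restricted Jacobi form\<close>

context lattice_splitting
begin

text \<open>Two uses are covered: with \<open>X\<close> the dual lattice and \<open>f\<close> the
  coefficients of \<Phi> these are the coefficients of the restriction, and with \<open>X\<close> a
  class of \<open>L\<close> and \<open>f\<close> constantly 1 they are the coefficients of
  \<open>theta_LM\<close>.\<close>

definition fiber_sum :: "(real ^ 'a \<Rightarrow> complex \<Rightarrow> complex) \<Rightarrow> (real ^ 'a) set \<Rightarrow> real ^ 'a \<Rightarrow> complex \<Rightarrow> complex" where
  "fiber_sum f X \<mu> \<tau> = (\<Sum>\<^sub>\<infinity>x\<in>{x\<in>X. prM x = \<mu>}. f x \<tau> * gauss_exp B w \<tau> x)"

text \<open>The Gaussian of \<open>u\<close> and the exponential of the pairing with \<xi> depend on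
  \<open>x\<close> only through \<open>prM x\<close>, so they come out of the sum over each
  fiber.\<close>

lemma has_sum_fiber_sum:
  assumes "((\<lambda>x. f x \<tau> * (gauss_exp B v \<tau> x * e2pi (cform B (cvec x) \<xi>))) has_sum s) X"
    and "X \<subseteq> dual_lattice B L" and "\<xi> \<in> complexify (span M)"
  shows "((\<lambda>\<mu>. fiber_sum f X \<mu> \<tau> * (gauss_exp B u \<tau> \<mu> * e2pi (cform B (cvec \<mu>) \<xi>))) has_sum s)
    (dual_lattice B M)"
proof -
  have "((\<lambda>\<mu>. \<Sum>\<^sub>\<infinity>x\<in>{x\<in>X. prM x = \<mu>}. f x \<tau> * (gauss_exp B v \<tau> x * e2pi (cform B (cvec x) \<xi>)))
      has_sum s) (dual_lattice B M)"
    by (rule has_sum_fibers[OF assms(1)]) (use assms(2) prM_dual in blast)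
  moreover have "(\<Sum>\<^sub>\<infinity>x\<in>{x\<in>X. prM x = \<mu>}. f x \<tau> * (gauss_exp B v \<tau> x * e2pi (cform B (cvec x) \<xi>))) =
      fiber_sum f X \<mu> \<tau> * (gauss_exp B u \<tau> \<mu> * e2pi (cform B (cvec \<mu>) \<xi>))" for \<mu>
    unfolding fiber_sum_def infsum_cmult_left'[symmetric]
  proof (rule infsum_cong)
    fix x assume x: "x \<in> {x\<in>X. prM x = \<mu>}"
    then have "x \<in> span L" using assms(2) by (auto simp: dual_lattice_def)
    then show "f x \<tau> * (gauss_exp B v \<tau> x * e2pi (cform B (cvec x) \<xi>)) =
      f x \<tau> * gauss_exp B w \<tau> x * (gauss_exp B u \<tau> \<mu> * e2pi (cform B (cvec \<mu>) \<xi>))"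
      using gauss_exp_split[of x \<tau>] cform_prM[of x \<xi>] assms(3) x by simp
  qed
  ultimately show ?thesis by simp
qed

text \<open>Since the imaginary part of \<open>A\<tau>\<close> decays at most like \<open>1 / y\<close>, the crude polynomial bound for the
  Gaussian sums over the fibers suffices, and no modularity of theta functions is needed.\<close>

lemma lin_exp_growth_fiber_sum:
  assumes growth: "\<And>x. x \<in> dual_lattice B L \<Longrightarrow> lin_exp_growth (f x)"
    and periodic: "\<And>x \<sigma> \<tau>. x \<in> dual_lattice B L \<Longrightarrow> \<sigma> \<in> L \<Longrightarrow> \<tau> \<in> uhp \<Longrightarrow> f (x + \<sigma>) \<tau> = f x \<tau>"
    and \<mu>: "\<mu> \<in> dual_lattice B M"
  shows "lin_exp_growth (fiber_sum f (dual_lattice B L) \<mu>)"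
  unfolding lin_exp_growth_def
proof
  fix A assume A: "A \<in> SL2Z"
  let ?S = "{x \<in> dual_lattice B L. prM x = \<mu>}"
  obtain C where C: "\<And>X :: real set. bounded X \<Longrightarrow> \<exists>K\<ge>0. \<exists>Y.
      \<forall>x\<in>dual_lattice B L. \<forall>r\<in>X. \<forall>y>0. y \<ge> Y \<longrightarrow> norm (f x (mob A (Complex r y))) \<le> K * exp (C * y)"
    using uniform_lin_exp_growth[OF L Gr_nondeg[OF v] growth periodic A] by blast
  have \<mu>M: "\<mu> \<in> span M" using \<mu> by (simp add: dual_lattice_def)
  obtain c d :: real and n :: nat where cd: "c > 0" "d \<ge> 0" and
    summable: "\<And>t. t > 0 \<Longrightarrow> (\<lambda>x. exp (- t * majorant w x)) summable_on ?S" and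
    bound: "\<And>t. t > 0 \<Longrightarrow> (\<Sum>\<^sub>\<infinity>x\<in>?S. exp (- t * majorant w x)) \<le> exp (t * d / c) * (1 + 2 * c / t) ^ n"
    using fiber_gauss_bound[OF \<mu>M] by blast
  \<comment> \<open>Since 1 + s \<le> exp s, the power in \<open>bound\<close> is at most
    \<open>exp (\<kappa> / Im \<tau>)\<close>. Here \<open>c\<close> is the constant of the fiber
    bound, not a matrix entry.\<close>
  define \<kappa> where "\<kappa> = n * (2 * c / pi)"
  have \<kappa>: "\<kappa> \<ge> 0" using cd by (simp add: \<kappa>_def)
  \<comment> \<open>The summands come from the coefficients, from \<open>exp (t * d / c)\<close>
    with \<open>Im \<tau> \<le> y\<close>, and from the part of \<open>1 / Im \<tau>\<close> that is
    linear in \<open>y\<close>.\<close>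
  define C' where "C' = C + (pi * d / c + \<kappa> * (A $ 2 $ 1)\<^sup>2)"
  show "\<exists>C::real. \<forall>X::real set. bounded X \<longrightarrow> (\<exists>K Y. \<forall>x\<in>X. \<forall>y>0. y \<ge> Y \<longrightarrow>
      norm (fiber_sum f (dual_lattice B L) \<mu> (mob A (Complex x y))) \<le> K * exp (C * y))"
  proof (rule exI[of _ C'], intro allI impI)
    fix X :: "real set" assume X: "bounded X"
    then obtain R where R: "\<And>r. r \<in> X \<Longrightarrow> \<bar>r\<bar> \<le> R" by (auto simp: bounded_iff)
    obtain K Y where K: "K \<ge> 0" and KY: "\<And>x r y. x \<in> dual_lattice B L \<Longrightarrow> r \<in> X \<Longrightarrow> y > 0 \<Longrightarrow> y \<ge> Y \<Longrightarrow>
      norm (f x (mob A (Complex r y))) \<le> K * exp (C * y)" using C[OF X] by blast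
    define R' where "R' = (\<bar>A $ 2 $ 1\<bar> * R + \<bar>A $ 2 $ 2\<bar>)\<^sup>2"
    show "\<exists>K Y. \<forall>x\<in>X. \<forall>y>0. y \<ge> Y \<longrightarrow>
      norm (fiber_sum f (dual_lattice B L) \<mu> (mob A (Complex x y))) \<le> K * exp (C' * y)"
    \<comment> \<open>The 1 in the maximum is the height from which \<open>SL2Z_Im_bounds\<close>
      applies.\<close>
    proof (rule exI[of _ "K * exp (\<kappa> * R')"], rule exI[of _ "max 1 Y"], intro ballI allI impI)
      fix r y :: real assume r: "r \<in> X" and y: "y > 0" "y \<ge> max 1 Y"
      define \<tau> where "\<tau> = mob A (Complex r y)"
      define t where "t = pi * Im \<tau>"
      have Im: "Im \<tau> \<le> y" "Im \<tau> > 0" "1 / Im \<tau> \<le> R' + (A $ 2 $ 1)\<^sup>2 * y"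
        using SL2Z_Im_bounds[OF A R[OF r], of y] y by (auto simp: \<tau>_def R'_def)
      then have t: "t > 0" by (simp add: t_def)
      have le: "norm (f x \<tau> * gauss_exp B w \<tau> x) \<le> K * exp (C * y) * exp (- t * majorant w x)"
        if "x \<in> ?S" for x
        unfolding norm_mult norm_gauss_exp t_def
        by (rule mult_right_mono) (use KY[of x r y] that r y in \<open>auto simp: \<tau>_def\<close>)
      have sm: "(\<lambda>x. K * exp (C * y) * exp (- t * majorant w x)) summable_on ?S"
        by (rule summable_on_cmult_right[OF summable[OF t]])
      have sf: "(\<lambda>x. f x \<tau> * gauss_exp B w \<tau> x) summable_on ?S"
        by (rule abs_summable_summable[OF Infinite_Sum.abs_summable_on_comparison_test'[OF sm le]])
      have "norm (fiber_sum f (dual_lattice B L) \<mu> \<tau>) \<le> (\<Sum>\<^sub>\<infinity>x\<in>?S. K * exp (C * y) * exp (- t * majorant w x))"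
        unfolding fiber_sum_def
        using norm_infsum_le[OF has_sum_infsum[OF sf] has_sum_infsum[OF sm] le] by blast
      also have "\<dots> = K * exp (C * y) * (\<Sum>\<^sub>\<infinity>x\<in>?S. exp (- t * majorant w x))"
        by (rule infsum_cmult_right')
      also have "\<dots> \<le> K * exp (C * y) * (exp (pi * d / c * y) * exp (\<kappa> * (R' + (A $ 2 $ 1)\<^sup>2 * y)))"
      proof (intro mult_left_mono)
        have "t * d / c \<le> pi * d / c * y"
          using Im cd by (simp add: t_def divide_right_mono mult_left_mono mult_right_mono mult_ac)
        moreover have "(1 + 2 * c / t) ^ n \<le> exp (\<kappa> * (R' + (A $ 2 $ 1)\<^sup>2 * y))"
        proof -
          have "(1 + 2 * c / t) ^ n \<le> exp (2 * c / t) ^ n"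
            by (rule power_mono) (use cd t in auto)
          also have "\<dots> = exp (\<kappa> * (1 / Im \<tau>))"
            by (simp add: \<kappa>_def t_def flip: exp_of_nat_mult)
          also have "\<dots> \<le> exp (\<kappa> * (R' + (A $ 2 $ 1)\<^sup>2 * y))"
            using mult_left_mono[OF Im(3) \<kappa>] by simp
          finally show ?thesis .
        qed
        ultimately have "exp (t * d / c) * (1 + 2 * c / t) ^ n \<le>
            exp (pi * d / c * y) * exp (\<kappa> * (R' + (A $ 2 $ 1)\<^sup>2 * y))"
          using cd t by (intro mult_mono) auto
        then show "(\<Sum>\<^sub>\<infinity>x\<in>?S. exp (- t * majorant w x)) \<le>
            exp (pi * d / c * y) * exp (\<kappa> * (R' + (A $ 2 $ 1)\<^sup>2 * y))"
          using bound[OF t] by linarith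
      qed (use K in auto)
      also have "\<dots> = K * exp (\<kappa> * R') * exp (C' * y)"
        by (simp add: C'_def algebra_simps exp_add)
      finally show "norm (fiber_sum f (dual_lattice B L) \<mu> (mob A (Complex r y))) \<le> K * exp (\<kappa> * R') * exp (C' * y)"
        by (simp add: \<tau>_def)
    qed
  qed
qed

text \<open>Smoothness, holomorphy and the transformation laws are inherited, and the fiber sums
  provide the Fourier expansion. As \<open>Res_LM\<close> is unspecified off its domain, all
  transformed arguments must be shown to stay in it; the determinant condition does this for
  \<open>mob A \<tau>\<close>.\<close>

lemma jacobi_form_restrict:
  assumes "jacobi_form k l B L v \<Gamma> \<Phi>" and \<Gamma>: "\<And>A \<phi>. (A, \<phi>) \<in> \<Gamma> \<Longrightarrow> det A = 1"
  shows "jacobi_form k l B M u \<Gamma> (Res_LM M \<Phi>)"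
proof -
  have Res: "Res_LM M \<Phi> (\<tau>, \<xi>) = \<Phi> (\<tau>, \<xi>)" if "\<tau> \<in> uhp" "\<xi> \<in> complexify (span M)" for \<tau> \<xi>
    using that by (simp add: Res_LM_def)
  note sub = complexify_mono[OF span_M_subset]
  note o = oproj_v_on_M
  note J = assms(1)[unfolded jacobi_form_def]
  have coproj: "coproj B (fst v) \<xi> = coproj B (fst u) \<xi>" "coproj B (snd v) \<xi> = coproj B (snd u) \<xi>"
    "coproj B (fst u) \<xi> \<in> complexify (span M)" "coproj B (snd u) \<xi> \<in> complexify (span M)"
    if "\<xi> \<in> complexify (span M)" for \<xi>
    unfolding coproj_def using that o[of "vRe \<xi>"] o[of "vIm \<xi>"]
    by (auto simp: complexify_def)
  from J obtain f where f: "\<And>\<tau> \<zeta>. \<tau> \<in> uhp \<Longrightarrow> \<zeta> \<in> complexify (span L) \<Longrightarrow>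
      ((\<lambda>x. f x \<tau> * (gauss_exp B v \<tau> x * e2pi (cform B (cvec x) \<zeta>))) has_sum \<Phi> (\<tau>, \<zeta>)) (dual_lattice B L)"
    and fg: "\<And>x. x \<in> dual_lattice B L \<Longrightarrow> lin_exp_growth (f x)" by blast
  have periodic: "f (x + \<sigma>) \<tau> = f x \<tau>" if "x \<in> dual_lattice B L" "\<sigma> \<in> L" "\<tau> \<in> uhp" for x \<sigma> \<tau>
    by (rule jacobi_form_coefficients_periodic[OF L v assms(1) f[OF that(3)] that(3,1,2)])
  show ?thesis
    unfolding jacobi_form_def
  proof (intro conjI)
    show "2 * k \<in> \<int>" "2 * l \<in> \<int>" using J by blast+
    show "smooth_on (uhp \<times> complexify (span M)) (Res_LM M \<Phi>)"
      by (rule smooth_on_subset_cong[of "uhp \<times> complexify (span L)" \<Phi>]) (use J sub Res in auto)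
    show "\<forall>\<tau>\<in>uhp. holomorphic_vec_on (\<lambda>\<zeta>. Res_LM M \<Phi> (\<tau>, \<zeta>)) (complexify (span M))"
    proof
      fix \<tau> assume \<tau>: "\<tau> \<in> uhp"
      then have "holomorphic_vec_on (\<lambda>\<zeta>. \<Phi> (\<tau>, \<zeta>)) (complexify (span L))" using J by blast
      then show "holomorphic_vec_on (\<lambda>\<zeta>. Res_LM M \<Phi> (\<tau>, \<zeta>)) (complexify (span M))"
        by (rule holomorphic_vec_on_subset_cong[OF _ sub]) (simp add: Res \<tau>)
    qed
    show "\<forall>\<tau>\<in>uhp. \<forall>\<zeta>\<in>complexify (span M). \<forall>\<sigma>\<in>M. \<forall>\<nu>\<in>M.
        Res_LM M \<Phi> (\<tau>, \<zeta> + \<tau> *s cvec (oproj B (fst u) \<sigma>) + cnj \<tau> *s cvec (oproj B (snd u) \<sigma>) + cvec \<nu>) =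
        e2pi (- \<tau> * of_real (B (oproj B (fst u) \<sigma>) (oproj B (fst u) \<sigma>)) / 2
              - cnj \<tau> * of_real (B (oproj B (snd u) \<sigma>) (oproj B (snd u) \<sigma>)) / 2
              - cform B (cvec \<sigma>) \<zeta>) * Res_LM M \<Phi> (\<tau>, \<zeta>)"
    proof (intro ballI)
      fix \<tau> \<xi> \<sigma> \<nu> assume *: "\<tau> \<in> uhp" "\<xi> \<in> complexify (span M)" "\<sigma> \<in> M" "\<nu> \<in> M"
      note o\<sigma> = o[OF span_base[OF *(3)]]
      have "\<xi> + \<tau> *s cvec (oproj B (fst u) \<sigma>) + cnj \<tau> *s cvec (oproj B (snd u) \<sigma>) + cvec \<nu> \<in> complexify (span M)"
        using * o\<sigma>(3,4) span_base[OF *(4)]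
        by (auto intro!: complexify_add complexify_smult complexify_cvec)
      moreover have "\<xi> \<in> complexify (span L)" "\<sigma> \<in> L" "\<nu> \<in> L" using * sub M_subset_L by auto
      ultimately show "Res_LM M \<Phi> (\<tau>, \<xi> + \<tau> *s cvec (oproj B (fst u) \<sigma>) + cnj \<tau> *s cvec (oproj B (snd u) \<sigma>) + cvec \<nu>) =
        e2pi (- \<tau> * of_real (B (oproj B (fst u) \<sigma>) (oproj B (fst u) \<sigma>)) / 2
              - cnj \<tau> * of_real (B (oproj B (snd u) \<sigma>) (oproj B (snd u) \<sigma>)) / 2
              - cform B (cvec \<sigma>) \<xi>) * Res_LM M \<Phi> (\<tau>, \<xi>)"
        using J *(1,2) by (simp only: Res flip: o\<sigma>(1,2))
    qed
    show "\<forall>\<tau>\<in>uhp. \<forall>\<zeta>\<in>complexify (span M). \<forall>(A, \<phi>)\<in>\<Gamma>.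
        Res_LM M \<Phi> (mob A \<tau>, inverse (autj A \<tau>) *s coproj B (fst u) \<zeta>
                     + inverse (cnj (autj A \<tau>)) *s coproj B (snd u) \<zeta>) =
        \<phi> \<tau> powi \<lfloor>2 * k\<rfloor> * cnj (\<phi> \<tau>) powi \<lfloor>2 * l\<rfloor> *
        e2pi (autj' A * cform B (coproj B (fst u) \<zeta>) (coproj B (fst u) \<zeta>) / (2 * autj A \<tau>)
              + autj' A * cform B (coproj B (snd u) \<zeta>) (coproj B (snd u) \<zeta>) / (2 * cnj (autj A \<tau>))) *
        Res_LM M \<Phi> (\<tau>, \<zeta>)"
    proof (intro ballI, clarify)
      fix \<tau> \<xi> A \<phi> assume *: "\<tau> \<in> uhp" "\<xi> \<in> complexify (span M)" "(A, \<phi>) \<in> \<Gamma>"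
      have "mob A \<tau> \<in> uhp" by (rule mob_simps(3)[OF *(1) \<Gamma>[OF *(3)]])
      moreover have "inverse (autj A \<tau>) *s coproj B (fst u) \<xi>
                     + inverse (cnj (autj A \<tau>)) *s coproj B (snd u) \<xi> \<in> complexify (span M)"
        using coproj(3,4)[OF *(2)] by (intro complexify_add complexify_smult) auto
      moreover have "\<Phi> (mob A \<tau>, inverse (autj A \<tau>) *s coproj B (fst v) \<xi>
                     + inverse (cnj (autj A \<tau>)) *s coproj B (snd v) \<xi>) =
        \<phi> \<tau> powi \<lfloor>2 * k\<rfloor> * cnj (\<phi> \<tau>) powi \<lfloor>2 * l\<rfloor> *
        e2pi (autj' A * cform B (coproj B (fst v) \<xi>) (coproj B (fst v) \<xi>) / (2 * autj A \<tau>)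
              + autj' A * cform B (coproj B (snd v) \<xi>) (coproj B (snd v) \<xi>) / (2 * cnj (autj A \<tau>))) *
        \<Phi> (\<tau>, \<xi>)"
        using J *(1,3) subsetD[OF sub *(2)] by blast
      ultimately show "Res_LM M \<Phi> (mob A \<tau>, inverse (autj A \<tau>) *s coproj B (fst u) \<xi>
                     + inverse (cnj (autj A \<tau>)) *s coproj B (snd u) \<xi>) =
        \<phi> \<tau> powi \<lfloor>2 * k\<rfloor> * cnj (\<phi> \<tau>) powi \<lfloor>2 * l\<rfloor> *
        e2pi (autj' A * cform B (coproj B (fst u) \<xi>) (coproj B (fst u) \<xi>) / (2 * autj A \<tau>)
              + autj' A * cform B (coproj B (snd u) \<xi>) (coproj B (snd u) \<xi>) / (2 * cnj (autj A \<tau>))) *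
        Res_LM M \<Phi> (\<tau>, \<xi>)"
        using *(1,2) by (simp only: Res coproj(1,2))
    qed
    show "\<exists>g. (\<forall>\<tau>\<in>uhp. \<forall>\<zeta>\<in>complexify (span M).
             ((\<lambda>x. g x \<tau> * (gauss_exp B u \<tau> x * e2pi (cform B (cvec x) \<zeta>))) has_sum Res_LM M \<Phi> (\<tau>, \<zeta>))
               (dual_lattice B M)) \<and>
          (\<forall>x\<in>dual_lattice B M. lin_exp_growth (g x))"
    proof (intro exI[of _ "fiber_sum f (dual_lattice B L)"] conjI ballI)
      fix \<tau> \<xi> assume *: "\<tau> \<in> uhp" "\<xi> \<in> complexify (span M)"
      show "((\<lambda>x. fiber_sum f (dual_lattice B L) x \<tau> * (gauss_exp B u \<tau> x * e2pi (cform B (cvec x) \<xi>)))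
          has_sum Res_LM M \<Phi> (\<tau>, \<xi>)) (dual_lattice B M)"
        unfolding Res[OF *] by (rule has_sum_fiber_sum[OF f order_refl]) (use * sub in auto)
    next
      show "lin_exp_growth (fiber_sum f (dual_lattice B L) \<mu>)" if "\<mu> \<in> dual_lattice B M" for \<mu>
        by (rule lin_exp_growth_fiber_sum[OF fg periodic that])
    qed
  qed
qed

section \<open>Restriction of theta functions and theta contraction\<close>

text \<open>Translation by an element of \<open>M\<close> moves \<open>prM\<close> by that element,
  so each coset of \<open>M\<close> whose projection has the class of \<mu> contains exactly one
  vector above \<mu>. The choice made by \<open>repr\<close> is harmless since the Gaussian of
  \<open>w\<close> is constant on cosets of \<open>M\<close>.\<close>

lemma theta_LM_eq_fiber_sum:
  assumes \<gamma>: "\<gamma> \<in> disc_group B L" and \<mu>: "\<mu> \<in> dual_lattice B M"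
  shows "theta_LM B L M w \<tau> \<gamma> (coset M \<mu>) = fiber_sum (\<lambda>_ _. 1) \<gamma> \<mu> \<tau>"
proof -
  define T where "T = {\<kappa> \<in> coset M ` dual_lattice B L. disc_proj B M (repr \<kappa>) = coset M \<mu> \<and> coset L (repr \<kappa>) = \<gamma>}"
  note mem = disc_group_partition[OF L \<gamma>]
  note ceq = coset_eq_iff[OF M] coset_eq_iff[OF L]
  have \<gamma>L: "x \<in> span L" if "x \<in> \<gamma>" for x using mem[of x] that by (simp add: dual_lattice_def)
  have shift: "gauss_exp B w \<tau> x = gauss_exp B w \<tau> y" "x \<in> \<gamma>" "prM x = prM y + (x - y)"
    if "x - y \<in> M" "y \<in> \<gamma>" for x y
  proof -
    have xy: "x - y \<in> span M" using that by (simp add: span_base)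
    show "gauss_exp B w \<tau> x = gauss_exp B w \<tau> y"
      using oproj_w_add[OF \<gamma>L[OF that(2)] xy] by (simp add: gauss_exp_def)
    show "prM x = prM y + (x - y)"
      using prM_add[OF \<gamma>L[OF that(2)] xy] by simp
    have "coset L x = coset L y" using that M_subset_L ceq by blast
    then show "x \<in> \<gamma>" using that(2) mem mem_coset_iff[OF L, of x y] by auto
  qed
  have rep: "repr (coset M x) - x \<in> M" for x
    using repr_coset[OF M, of x] ceq by simp
  have "bij_betw (coset M) {x\<in>\<gamma>. prM x = \<mu>} T"
    unfolding bij_betw_def
  proof
    show "inj_on (coset M) {x\<in>\<gamma>. prM x = \<mu>}"
    proof (rule inj_onI)
      fix x y assume xy: "x \<in> {x\<in>\<gamma>. prM x = \<mu>}" "y \<in> {x\<in>\<gamma>. prM x = \<mu>}" "coset M x = coset M y"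
      then have "x - y \<in> M" using ceq by simp
      from shift(3)[OF this] xy show "x = y" by simp
    qed
    show "coset M ` {x\<in>\<gamma>. prM x = \<mu>} = T"
    proof (intro equalityI subsetI)
      fix \<kappa> assume "\<kappa> \<in> coset M ` {x\<in>\<gamma>. prM x = \<mu>}"
      then obtain x where x: "x \<in> \<gamma>" "prM x = \<mu>" "\<kappa> = coset M x" by blast
      note s = shift[OF rep[of x] x(1)]
      have "disc_proj B M (repr \<kappa>) = coset M \<mu>"
        using rep[of x] s(3) by (simp add: disc_proj_def x ceq)
      then show "\<kappa> \<in> T" using x mem s(2) by (auto simp: T_def)
    next
      fix \<kappa> assume \<kappa>: "\<kappa> \<in> T"
      then obtain z where z: "z \<in> dual_lattice B L" "\<kappa> = coset M z" by (auto simp: T_def)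
      define r where "r = repr \<kappa>"
      have r: "coset L r = \<gamma>" "prM r - \<mu> \<in> M" "r - z \<in> M"
        using \<kappa> rep[of z] by (auto simp: T_def r_def z disc_proj_def ceq)
      have "coset L z = \<gamma>"
        using r(1,3) M_subset_L ceq(2)[of r z] by blast
      then have "z \<in> \<gamma>" using z mem by blast
      then have r\<gamma>: "r \<in> \<gamma>" using shift(2) r(3) by blast
      \<comment> \<open>Correcting \<open>r\<close> by the element \<open>prM r - \<mu>\<close> of
        \<open>M\<close> puts it above \<mu> without leaving the coset.\<close>
      define x where "x = r - (prM r - \<mu>)"
      have xr: "x - r \<in> M" using even_lattice_group(3)[OF M r(2)] by (simp add: x_def)
      have x: "x \<in> \<gamma>" "prM x = \<mu>" using shift(2,3)[OF xr r\<gamma>] by (auto simp: x_def)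
      have "coset M x = coset M r" using xr ceq by simp
      also have "\<dots> = \<kappa>" using r(3) ceq(1)[of r z] z by simp
      finally show "\<kappa> \<in> coset M ` {x\<in>\<gamma>. prM x = \<mu>}" using x by blast
    qed
  qed
  from infsum_reindex_bij_betw[OF this, of "\<lambda>\<kappa>. gauss_exp B w \<tau> (repr \<kappa>)"]
  have "(\<Sum>\<^sub>\<infinity>\<kappa>\<in>T. gauss_exp B w \<tau> (repr \<kappa>)) =
      (\<Sum>\<^sub>\<infinity>x\<in>{x\<in>\<gamma>. prM x = \<mu>}. gauss_exp B w \<tau> (repr (coset M x)))" by simp
  also have "\<dots> = (\<Sum>\<^sub>\<infinity>x\<in>{x\<in>\<gamma>. prM x = \<mu>}. gauss_exp B w \<tau> x)"
    by (rule infsum_cong) (use shift(1)[OF rep] in auto)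
  finally show ?thesis
    using \<gamma> \<mu> by (simp add: theta_LM_def fiber_sum_def T_def disc_group_def)
qed

text \<open>The fiber sum over a class of \<open>L\<close> depends on \<mu> only modulo
  \<open>M\<close>. Grouping the restricted series by the finitely many classes of \<open>M\<close>
  therefore pulls out \<open>theta_LM\<close> and leaves the theta function of
  \<open>M\<close>.\<close>

lemma siegel_theta_restrict:
  assumes \<gamma>: "\<gamma> \<in> disc_group B L" and \<tau>: "\<tau> \<in> uhp" and \<xi>: "\<xi> \<in> complexify (span M)"
  shows "siegel_theta B L v \<tau> \<xi> \<gamma> =
    (\<Sum>\<delta>\<in>disc_group B M. siegel_theta B M u \<tau> \<xi> \<delta> * theta_LM B L M w \<tau> \<gamma> \<delta>)"
proof -
  note mem = disc_group_partition[OF M]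
  let ?h = "\<lambda>\<mu>. gauss_exp B u \<tau> \<mu> * e2pi (cform B (cvec \<mu>) \<xi>)"
  let ?H = "\<lambda>\<mu>. fiber_sum (\<lambda>_ _. 1) \<gamma> \<mu> \<tau> * ?h \<mu>"
  have sub: "\<gamma> \<subseteq> dual_lattice B L" using disc_group_partition[OF L \<gamma>] by blast
  have "(\<lambda>x. gauss_exp B v \<tau> x * e2pi (cform B (cvec x) \<xi>)) summable_on \<gamma>"
    by (rule summable_on_subset[OF theta_term_summable[OF L v \<tau>] sub])
      (use \<xi> complexify_mono[OF span_M_subset] in auto)
  then have "((\<lambda>x. gauss_exp B v \<tau> x * e2pi (cform B (cvec x) \<xi>)) has_sum siegel_theta B L v \<tau> \<xi> \<gamma>) \<gamma>"
    using \<gamma> by (simp add: siegel_theta_def)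
  then have *: "(?H has_sum siegel_theta B L v \<tau> \<xi> \<gamma>) (dual_lattice B M)"
    using has_sum_fiber_sum[of "\<lambda>_ _. 1", OF _ sub \<xi>] by simp
  have Un: "dual_lattice B M = \<Union> (disc_group B M)"
    using mem mem_coset_iff[OF M] by (auto simp: disc_group_def)
  have "siegel_theta B L v \<tau> \<xi> \<gamma> = infsum ?H (\<Union>\<delta>\<in>disc_group B M. \<delta>)"
    using infsumI[OF *] by (simp add: Un)
  also have "\<dots> = (\<Sum>\<delta>\<in>disc_group B M. infsum ?H \<delta>)"
  proof (rule sum_infsum[symmetric])
    show "finite (disc_group B M)" by (rule finite_disc_group[OF M Gr_nondeg[OF u]])
    show "?H summable_on \<delta>" if "\<delta> \<in> disc_group B M" for \<delta>
      by (rule summable_on_subset[OF has_sum_imp_summable[OF *]]) (use that Un in auto)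
    show "\<delta> \<inter> \<delta>' = {}" if "\<delta> \<in> disc_group B M" "\<delta>' \<in> disc_group B M" "\<delta> \<noteq> \<delta>'" for \<delta> \<delta>'
      using mem that by blast
  qed
  also have "\<dots> = (\<Sum>\<delta>\<in>disc_group B M. siegel_theta B M u \<tau> \<xi> \<delta> * theta_LM B L M w \<tau> \<gamma> \<delta>)"
  proof (rule sum.cong[OF refl])
    fix \<delta> assume \<delta>: "\<delta> \<in> disc_group B M"
    have "infsum ?H \<delta> = (\<Sum>\<^sub>\<infinity>\<mu>\<in>\<delta>. ?h \<mu> * theta_LM B L M w \<tau> \<gamma> \<delta>)"
    proof (rule infsum_cong)
      fix \<mu> assume "\<mu> \<in> \<delta>"
      then have "\<mu> \<in> dual_lattice B M" "coset M \<mu> = \<delta>" using mem[OF \<delta>] by auto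
      then show "?H \<mu> = ?h \<mu> * theta_LM B L M w \<tau> \<gamma> \<delta>"
        using theta_LM_eq_fiber_sum[OF \<gamma>, of \<mu> \<tau>] by simp
    qed
    also have "\<dots> = siegel_theta B M u \<tau> \<xi> \<delta> * theta_LM B L M w \<tau> \<gamma> \<delta>"
      using \<delta> by (simp add: infsum_cmult_left' siegel_theta_def)
    finally show "infsum ?H \<delta> = siegel_theta B M u \<tau> \<xi> \<delta> * theta_LM B L M w \<tau> \<gamma> \<delta>" .
  qed
  finally show ?thesis .
qed

lemma Phi_of_restrict:
  assumes "\<tau> \<in> uhp" "\<xi> \<in> complexify (span M)"
  shows "Phi_of B L v F (\<tau>, \<xi>) = Phi_of B M u (theta_contraction B L M w F) (\<tau>, \<xi>)"
proof -
  have "Phi_of B L v F (\<tau>, \<xi>) = (\<Sum>\<gamma>\<in>disc_group B L. \<Sum>\<delta>\<in>disc_group B M.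
      siegel_theta B M u \<tau> \<xi> \<delta> * (theta_LM B L M w \<tau> \<gamma> \<delta> * F \<tau> \<gamma>))"
    using siegel_theta_restrict[OF _ assms]
    by (simp add: Phi_of_def pairing_def sum_distrib_right mult.assoc)
  also have "\<dots> = Phi_of B M u (theta_contraction B L M w F) (\<tau>, \<xi>)"
    by (subst sum.swap) (simp add: Phi_of_def pairing_def theta_contraction_def sum_distrib_left)
  finally show ?thesis .
qed

end

theorem proposition3p8:
  fixes B :: "real ^ 'n \<Rightarrow> real ^ 'n \<Rightarrow> real"
    and L M :: "(real ^ 'n) set"
    and u w v :: "(real ^ 'n) set \<times> (real ^ 'n) set"
    and bp bm cp cm :: nat
    and k l :: real
    and \<Gamma> :: "mp set"
    and \<Phi> :: "complex \<times> (complex ^ 'n) \<Rightarrow> complex"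
  assumes "even_lattice B L" and "signature B L = (bp, bm)"
    and "primitive_nondeg_sublattice B M L" and "signature B M = (cp, cm)"
    and "v \<in> Gr B (span L)" and "u \<in> Gr B (span M)" and "w \<in> Gr B (orth_compl B L M)"
    and "v = Gr_sum u w"
    and "finite_index_subgroup \<Gamma>"
    and "jacobi_form k l B L v \<Gamma> \<Phi>"
  shows "jacobi_form k l B M u \<Gamma> (Res_LM M \<Phi>) \<and>
    (\<forall>F. modular_form (k - real bp / 2) (l - real bm / 2) B L \<Gamma> F \<and>
         (\<forall>\<tau>\<in>uhp. \<forall>\<zeta>\<in>complexify (span L). \<Phi> (\<tau>, \<zeta>) = Phi_of B L v F (\<tau>, \<zeta>)) \<longrightarrow>
         (\<forall>\<tau>\<in>uhp. \<forall>\<xi>\<in>complexify (span M).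
            Res_LM M \<Phi> (\<tau>, \<xi>) = Phi_of B M u (theta_contraction B L M w F) (\<tau>, \<xi>)))"
proof -
  interpret lattice_splitting B L M u w v
    by unfold_locales
      (use assms in \<open>auto simp: even_lattice_def primitive_nondeg_sublattice_def\<close>)
  \<comment> \<open>Membership in \<open>Mp2Z\<close> supplies the determinant condition under which
    the Moebius action preserves \<open>uhp\<close>.\<close>
  have "\<Gamma> \<subseteq> carrier Mp2Z"
    using assms(9) subgroup.subset unfolding finite_index_subgroup_def by blast
  then have \<Gamma>: "det A = 1" if "(A, \<phi>) \<in> \<Gamma>" for A \<phi>
    using that by (auto simp: Mp2Z_def Mp2R_def)
  show ?thesis
  proof (intro conjI allI impI ballI)
    show "jacobi_form k l B M u \<Gamma> (Res_LM M \<Phi>)"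
      by (rule jacobi_form_restrict[OF assms(10) \<Gamma>])
  next
    fix F \<tau> \<xi>
    assume F: "modular_form (k - real bp / 2) (l - real bm / 2) B L \<Gamma> F \<and>
         (\<forall>\<tau>\<in>uhp. \<forall>\<zeta>\<in>complexify (span L). \<Phi> (\<tau>, \<zeta>) = Phi_of B L v F (\<tau>, \<zeta>))"
      and \<tau>: "\<tau> \<in> uhp" and \<xi>: "\<xi> \<in> complexify (span M)"
    have "\<xi> \<in> complexify (span L)" using \<xi> complexify_mono[OF span_M_subset] by blast
    then show "Res_LM M \<Phi> (\<tau>, \<xi>) = Phi_of B M u (theta_contraction B L M w F) (\<tau>, \<xi>)"
      using F \<tau> \<xi> Phi_of_restrict[OF \<tau> \<xi>] by (simp add: Res_LM_def)
  qed
qed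

end
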